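(* Let $k$ be a field of characteristic $p$, $G$ a finite group, $R$ a commutative graded $k$-algebra, $S$ a graded $RG$-module and $M$ a finite dimensional indecomposable $kG$-module. If $R$ is Noetherian and $S$ is finite over $R$, then $\operatorname{Hom}^{\mathcal X}_{kG}(M,S)$ (for any set $\mathcal X$ of $p$-subgroups of $G$), $\operatorname{Hom}^{\oplus}_{kG}(M,S)$, $S^{[G]}$ and $S^{\oplus G}$ are all finite over $R$.
   Context: $R$ carries trivial $G$-action, and acts on spaces of homomorphisms into $S$ by multiplication on values. "Finite over $R$" means finitely generated as an $R$-module. Characteristic $p=0$ is allowed; then the only $p$-subgroup is the trivial group. For a set $\mathcal X$ of $p$-subgroups of $G$ and $kG$-modules $M,N$, $\operatorname{Hom}^{\mathcal X}_{kG}(M,N)$ is the quotient of $\operatorname{Hom}_{kG}(M,N)$ by the sum of the images of the transfer maps $\operatorname{tr}^G_P:\operatorname{Hom}_{kP}(M,N)\to\operatorname{Hom}_{kG}(M,N)$, $f\mapsto \sum_{g\in G/P}gfg^{-1}$, for all $P\in\mathcal X$. $N^{[G]}:=\operatorname{Hom}^{\mathcal X}_{kG}(k,N)$ for $\mathcal X$ the set of all $p$-subgroups of $G$ that are not Sylow $p$-subgroups. For $M$ finite dimensional indecomposable, $J_G(M,N)\subseteq\operatorname{Hom}_{kG}(M,N)$ is the subspace of homomorphisms that are not split injective, $\operatorname{Hom}^{\oplus}_{kG}(M,N):=\operatorname{Hom}_{kG}(M,N)/J_G(M,N)$, and $N^{\oplus G}:=\operatorname{Hom}^{\oplus}_{kG}(k,N)$,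 with $k$ the trivial module. *)

theory Defs
  imports "HOL-Algebra.Group_Action" "HOL-Algebra.Left_Coset" "HOL-Algebra.Ring_Divisibility"
begin

section \<open>Finitely generated modules and quotients\<close>

text \<open>Over a field, \<open>finite_module\<close> means finite dimensional.\<close>

locale finite_module = module +
  assumes finitely_generated:
    "\<exists>A\<subseteq>carrier M. finite A \<and>
       (\<forall>x\<in>carrier M. \<exists>c\<in>A \<rightarrow> carrier R. x = (\<Oplus>\<^bsub>M\<^esub>a\<in>A. c a \<odot>\<^bsub>M\<^esub> a))"

text \<open>
  The record of modules extends the record of rings, but the multiplicative fields
  play no role for modules; they are left \<open>undefined\<close> below.
\<close>

definition quotient_module ::
    "('a, 'b, 'c) module_scheme \<Rightarrow> 'b set \<Rightarrow> ('a, 'b set) module"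
  where "quotient_module M N =
    \<lparr>carrier = a_rcosets\<^bsub>M\<^esub> N, monoid.mult = undefined, one = undefined,
     zero = N, add = set_add M,
     smult = (\<lambda>a C. \<Union>x\<in>C. N +>\<^bsub>M\<^esub> (a \<odot>\<^bsub>M\<^esub> x))\<rparr>"

definition ring_characteristic :: "('a, 'b) ring_scheme \<Rightarrow> nat"
  where "ring_characteristic R =
    (if \<exists>n::nat. n > 0 \<and> [n] \<cdot>\<^bsub>R\<^esub> \<one>\<^bsub>R\<^esub> = \<zero>\<^bsub>R\<^esub>
     then LEAST n::nat. n > 0 \<and> [n] \<cdot>\<^bsub>R\<^esub> \<one>\<^bsub>R\<^esub> = \<zero>\<^bsub>R\<^esub> else 0)"


section \<open>Modules with a linear group action\<close>

text \<open>
  A module over the group ring \<open>KG\<close> is a \<open>K\<close>-module together with a \<open>K\<close>-linear action of \<open>G\<close>.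
  The action is an extra field of the module record.
\<close>

record ('k, 'v, 'g) gmodule = "('k, 'v) module" +
  act :: "'g \<Rightarrow> 'v \<Rightarrow> 'v"

locale group_module =
  module K M + action: group_action G "carrier M" "act M"
  for K :: "('k, 'c) ring_scheme" and G :: "('g, 'd) monoid_scheme"
    and M :: "('k, 'v, 'g) gmodule" +
  assumes act_add: "\<lbrakk>g \<in> carrier G; x \<in> carrier M; y \<in> carrier M\<rbrakk>
      \<Longrightarrow> act M g (x \<oplus>\<^bsub>M\<^esub> y) = act M g x \<oplus>\<^bsub>M\<^esub> act M g y"
    and act_smult: "\<lbrakk>g \<in> carrier G; a \<in> carrier K; x \<in> carrier M\<rbrakk>
      \<Longrightarrow> act M g (a \<odot>\<^bsub>M\<^esub> x) = a \<odot>\<^bsub>M\<^esub> act M g x"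

definition group_submodule ::
    "'v set \<Rightarrow> ('k, 'c) ring_scheme \<Rightarrow> ('g, 'd) monoid_scheme \<Rightarrow> ('k, 'v, 'g) gmodule \<Rightarrow> bool"
  where "group_submodule U K G M \<longleftrightarrow>
    submodule U K M \<and> (\<forall>g\<in>carrier G. \<forall>x\<in>U. act M g x \<in> U)"

definition indecomposable ::
    "('k, 'c) ring_scheme \<Rightarrow> ('g, 'd) monoid_scheme \<Rightarrow> ('k, 'v, 'g) gmodule \<Rightarrow> bool"
  where "indecomposable K G M \<longleftrightarrow>
    carrier M \<noteq> {\<zero>\<^bsub>M\<^esub>} \<and>
    (\<forall>U V. group_submodule U K G M \<and> group_submodule V K G M \<and>
       U \<inter> V = {\<zero>\<^bsub>M\<^esub>} \<and> U <+>\<^bsub>M\<^esub> V = carrier M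
       \<longrightarrow> U = {\<zero>\<^bsub>M\<^esub>} \<or> V = {\<zero>\<^bsub>M\<^esub>})"

definition trivial_module ::
    "('k, 'c) ring_scheme \<Rightarrow> ('k, 'k, 'g) gmodule"
  where "trivial_module K =
    \<lparr>carrier = carrier K, monoid.mult = monoid.mult K, one = one K, zero = zero K, add = add K,
     smult = monoid.mult K, act = (\<lambda>g. \<lambda>x\<in>carrier K. x)\<rparr>"

text \<open>The \<open>kG\<close>-module underlying an \<open>RG\<close>-module, for a \<open>k\<close>-algebra \<open>R\<close>.\<close>

definition restrict_scalars ::
    "('k, 'r) module \<Rightarrow> ('r, 'v, 'g) gmodule \<Rightarrow> ('k, 'v, 'g) gmodule"
  where "restrict_scalars R S =
    \<lparr>carrier = carrier S, monoid.mult = monoid.mult S, one = one S, zero = zero S, add = add S,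
     smult = (\<lambda>c x. (c \<odot>\<^bsub>R\<^esub> \<one>\<^bsub>R\<^esub>) \<odot>\<^bsub>S\<^esub> x), act = act S\<rparr>"


section \<open>Gradings\<close>

text \<open>Gradings are indexed by the integers; a grading by the natural numbers is the special case
  in which the negative components vanish.\<close>

definition direct_sum_decomposition :: "('a, 'c) ring_scheme \<Rightarrow> (int \<Rightarrow> 'a set) \<Rightarrow> bool"
  where "direct_sum_decomposition M D \<longleftrightarrow>
    (\<forall>i. additive_subgroup (D i) M) \<and>
    (\<forall>x\<in>carrier M. \<exists>!f. (\<forall>i. f i \<in> D i) \<and> finite {i. f i \<noteq> \<zero>\<^bsub>M\<^esub>} \<and>
       x = (\<Oplus>\<^bsub>M\<^esub>i\<in>{i. f i \<noteq> \<zero>\<^bsub>M\<^esub>}. f i))"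

locale graded_algebra = algebra k R
  for k :: "('k, 'c) ring_scheme" and R :: "('k, 'r) module" +
  fixes D :: "int \<Rightarrow> 'r set"
  assumes decomposition: "direct_sum_decomposition R D"
    and component_submodule: "submodule (D i) k R"
    and one_degree: "\<one>\<^bsub>R\<^esub> \<in> D 0"
    and mult_degree: "\<lbrakk>x \<in> D i; y \<in> D j\<rbrakk> \<Longrightarrow> x \<otimes>\<^bsub>R\<^esub> y \<in> D (i + j)"

text \<open>Graded \<open>RG\<close>-modules, where \<open>R\<close> is graded by \<open>D\<close> and \<open>G\<close> acts trivially on \<open>R\<close>.\<close>

locale graded_group_module = group_module R G S
  for R :: "('k, 'r) module" and D :: "int \<Rightarrow> 'r set"
    and G :: "('g, 'd) monoid_scheme" and S :: "('r, 's, 'g) gmodule" +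
  fixes E :: "int \<Rightarrow> 's set"
  assumes decomposition: "direct_sum_decomposition S E"
    and smult_degree: "\<lbrakk>a \<in> D i; x \<in> E j\<rbrakk> \<Longrightarrow> a \<odot>\<^bsub>S\<^esub> x \<in> E (i + j)"
    and act_degree: "\<lbrakk>g \<in> carrier G; x \<in> E i\<rbrakk> \<Longrightarrow> act S g x \<in> E i"


section \<open>\<open>p\<close>-subgroups\<close>

text \<open>For \<open>p = 0\<close> the only \<open>p\<close>-subgroup is the trivial one, because \<open>0 ^ n\<close> is \<open>1\<close> for \<open>n = 0\<close>
  and \<open>0\<close> otherwise.\<close>

definition p_subgroup :: "nat \<Rightarrow> ('g, 'd) monoid_scheme \<Rightarrow> 'g set \<Rightarrow> bool"
  where "p_subgroup p G P \<longleftrightarrow> subgroup P G \<and> finite P \<and> (\<exists>n. card P = p ^ n)"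

definition sylow_subgroup :: "nat \<Rightarrow> ('g, 'd) monoid_scheme \<Rightarrow> 'g set \<Rightarrow> bool"
  where "sylow_subgroup p G P \<longleftrightarrow>
    p_subgroup p G P \<and> (\<forall>Q. p_subgroup p G Q \<and> P \<subseteq> Q \<longrightarrow> Q = P)"


section \<open>Homomorphisms and transfer\<close>

text \<open>\<open>Hom_over K P M N\<close> is the set of \<open>KP\<close>-homomorphisms, represented by functions that are
  \<open>undefined\<close> outside the carrier of \<open>M\<close>.\<close>

definition Hom_over ::
    "('k, 'c) ring_scheme \<Rightarrow> 'g set \<Rightarrow> ('k, 'm, 'g) gmodule \<Rightarrow> ('k, 'n, 'g) gmodule \<Rightarrow> ('m \<Rightarrow> 'n) set"
  where "Hom_over K P M N =
    {f \<in> carrier M \<rightarrow>\<^sub>E carrier N.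
       (\<forall>x\<in>carrier M. \<forall>y\<in>carrier M. f (x \<oplus>\<^bsub>M\<^esub> y) = f x \<oplus>\<^bsub>N\<^esub> f y) \<and>
       (\<forall>a\<in>carrier K. \<forall>x\<in>carrier M. f (a \<odot>\<^bsub>M\<^esub> x) = a \<odot>\<^bsub>N\<^esub> f x) \<and>
       (\<forall>g\<in>P. \<forall>x\<in>carrier M. f (act M g x) = act N g (f x))}"

text \<open>On \<open>KP\<close>-homomorphisms the summand does not depend on the representative of the coset.\<close>

definition transfer ::
    "('g, 'd) monoid_scheme \<Rightarrow> 'g set \<Rightarrow> ('k, 'm, 'g) gmodule \<Rightarrow> ('k, 'n, 'g) gmodule
      \<Rightarrow> ('m \<Rightarrow> 'n) \<Rightarrow> 'm \<Rightarrow> 'n"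
  where "transfer G P M N f =
    (\<lambda>x\<in>carrier M. \<Oplus>\<^bsub>N\<^esub>C\<in>lcosets\<^bsub>G\<^esub> P.
       let g = SOME g. g \<in> C in act N g (f (act M (inv\<^bsub>G\<^esub> g) x)))"

text \<open>The sum of the images of the transfer maps from the members of the finite set \<open>\<X>\<close>.\<close>

definition transfer_sum ::
    "('k, 'c) ring_scheme \<Rightarrow> ('g, 'd) monoid_scheme \<Rightarrow> 'g set set
      \<Rightarrow> ('k, 'm, 'g) gmodule \<Rightarrow> ('k, 'n, 'g) gmodule \<Rightarrow> ('m \<Rightarrow> 'n) set"
  where "transfer_sum K G \<X> M N =
    {\<lambda>x\<in>carrier M. \<Oplus>\<^bsub>N\<^esub>P\<in>\<X>. t P x | t.
       t \<in> (\<Pi> P\<in>\<X>. transfer G P M N ` Hom_over K P M N)}"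

definition split_injective ::
    "('k, 'c) ring_scheme \<Rightarrow> ('g, 'd) monoid_scheme
      \<Rightarrow> ('k, 'm, 'g) gmodule \<Rightarrow> ('k, 'n, 'g) gmodule \<Rightarrow> ('m \<Rightarrow> 'n) \<Rightarrow> bool"
  where "split_injective K G M N f \<longleftrightarrow>
    (\<exists>h\<in>Hom_over K (carrier G) N M. \<forall>x\<in>carrier M. h (f x) = x)"

definition J_hom ::
    "('k, 'c) ring_scheme \<Rightarrow> ('g, 'd) monoid_scheme
      \<Rightarrow> ('k, 'm, 'g) gmodule \<Rightarrow> ('k, 'n, 'g) gmodule \<Rightarrow> ('m \<Rightarrow> 'n) set"
  where "J_hom K G M N = {f \<in> Hom_over K (carrier G) M N. \<not> split_injective K G M N f}"

text \<open>For an \<open>RG\<close>-module \<open>S\<close>, the space \<open>Hom\<^bsub>kG\<^esub>(M, S)\<close> as an \<open>R\<close>-module: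
  \<open>R\<close> acts by multiplication on values.\<close>

definition Hom_module ::
    "('k, 'c) ring_scheme \<Rightarrow> ('k, 'r) module \<Rightarrow> ('g, 'd) monoid_scheme
      \<Rightarrow> ('k, 'm, 'g) gmodule \<Rightarrow> ('r, 's, 'g) gmodule \<Rightarrow> ('r, 'm \<Rightarrow> 's) module"
  where "Hom_module k R G M S =
    \<lparr>carrier = Hom_over k (carrier G) M (restrict_scalars R S),
     monoid.mult = undefined, one = undefined,
     zero = (\<lambda>x\<in>carrier M. \<zero>\<^bsub>S\<^esub>),
     add = (\<lambda>f g. \<lambda>x\<in>carrier M. f x \<oplus>\<^bsub>S\<^esub> g x),
     smult = (\<lambda>r f. \<lambda>x\<in>carrier M. r \<odot>\<^bsub>S\<^esub> f x)\<rparr>"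

text \<open>\<open>Hom\<^sup>\<X>\<^bsub>kG\<^esub>(M, S)\<close>, the quotient by the sum of the images of transfer, and
  \<open>Hom\<^sup>\<oplus>\<^bsub>kG\<^esub>(M, S)\<close>, the quotient by the homomorphisms that are not split injective.\<close>

definition Hom_rel ::
    "('k, 'c) ring_scheme \<Rightarrow> ('k, 'r) module \<Rightarrow> ('g, 'd) monoid_scheme \<Rightarrow> 'g set set
      \<Rightarrow> ('k, 'm, 'g) gmodule \<Rightarrow> ('r, 's, 'g) gmodule \<Rightarrow> ('r, ('m \<Rightarrow> 's) set) module"
  where "Hom_rel k R G \<X> M S =
    quotient_module (Hom_module k R G M S) (transfer_sum k G \<X> M (restrict_scalars R S))"

definition Hom_split ::
    "('k, 'c) ring_scheme \<Rightarrow> ('k, 'r) module \<Rightarrow> ('g, 'd) monoid_scheme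
      \<Rightarrow> ('k, 'm, 'g) gmodule \<Rightarrow> ('r, 's, 'g) gmodule \<Rightarrow> ('r, ('m \<Rightarrow> 's) set) module"
  where "Hom_split k R G M S =
    quotient_module (Hom_module k R G M S) (J_hom k G M (restrict_scalars R S))"

text \<open>\<open>S\<^sup>[\<^sup>G\<^sup>]\<close> (Brauer quotient) and \<open>S\<^sup>\<oplus>\<^sup>G\<close>.\<close>

definition brauer_quotient ::
    "nat \<Rightarrow> ('k, 'c) ring_scheme \<Rightarrow> ('k, 'r) module \<Rightarrow> ('g, 'd) monoid_scheme
      \<Rightarrow> ('r, 's, 'g) gmodule \<Rightarrow> ('r, ('k \<Rightarrow> 's) set) module"
  where "brauer_quotient p k R G S =
    Hom_rel k R G {P. p_subgroup p G P \<and> \<not> sylow_subgroup p G P} (trivial_module k) S"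

definition split_quotient ::
    "('k, 'c) ring_scheme \<Rightarrow> ('k, 'r) module \<Rightarrow> ('g, 'd) monoid_scheme
      \<Rightarrow> ('r, 's, 'g) gmodule \<Rightarrow> ('r, ('k \<Rightarrow> 's) set) module"
  where "split_quotient k R G S = Hom_split k R G (trivial_module k) S"

end

theory Submission
  imports Defs
begin

text \<open>
  Over a Noetherian ring, submodules and quotients of finitely generated modules are finitely
  generated. So it suffices that \<open>Hom\<^bsub>kG\<^esub>(M, S)\<close> is a Noetherian \<open>R\<close>-module and that the two subspaces
  divided out, the sum of the images of transfer and the set \<open>J\<^bsub>G\<^esub>(M, S)\<close>, are \<open>R\<close>-submodules of it.

  A homomorphism is determined by its values on a finite generating set of \<open>M\<close>. Evaluating at one
  generator after the other exhibits \<open>Hom\<^bsub>kG\<^esub>(M, S)\<close> as an iterated extension of submodules of the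
  Noetherian module \<open>S\<close> (\<open>Hom_module_noetherian\<close>).

  The ring \<open>R\<close> acts on \<open>S\<close> by \<open>kG\<close>-endomorphisms, and transfer commutes with composition by
  \<open>kG\<close>-homomorphisms of the target (\<open>transfer_compose\<close>), so the images of transfer are
  \<open>R\<close>-submodules (\<open>transfer_sum_submodule\<close>).

  That \<open>J\<^bsub>G\<^esub>(M, S)\<close> is closed under multiples is immediate: precomposing a splitting of \<open>r f\<close> with
  multiplication by \<open>r\<close> splits \<open>f\<close>. Closure under addition uses that the endomorphism ring of the finite
  dimensional indecomposable module \<open>M\<close> is local, in the form that every endomorphism is bijective or
  nilpotent (\<open>endomorphism_bij_or_nilpotent\<close>). This follows from Fitting's decomposition of \<open>M\<close> into
  the kernel and the image of a high power of the endomorphism. In place of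
  dimension counting, the decomposition is derived from the ascending chain condition and division by
  nonzero scalars (\<open>carrier_eq_kernel_plus_image\<close>).

  The Brauer quotient \<open>S\<^sup>[\<^sup>G\<^sup>]\<close> and \<open>S\<^sup>\<oplus>\<^sup>G\<close> are the special cases in which \<open>M\<close> is the trivial module, which is
  one-dimensional and therefore indecomposable.
\<close>

section \<open>Spans and Noetherian submodules\<close>

context module
begin

text \<open>
  This is the span only for finite \<open>A\<close>: a formal sum over an infinite index set has value zero by
  convention.
\<close>

definition lin_span where
  "lin_span A = {\<Oplus>\<^bsub>M\<^esub>a\<in>A. c a \<odot>\<^bsub>M\<^esub> a | c. c \<in> A \<rightarrow> carrier R}"

lemma smult_fun_closed:
  "\<lbrakk>A \<subseteq> carrier M; c \<in> A \<rightarrow> carrier R\<rbrakk> \<Longrightarrow> (\<lambda>a. c a \<odot>\<^bsub>M\<^esub> a) \<in> A \<rightarrow> carrier M"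
  by (auto simp: Pi_def)

lemma submodule_zero_closed: "submodule U R M \<Longrightarrow> \<zero>\<^bsub>M\<^esub> \<in> U"
  using subgroup.one_closed[OF submodule.axioms(1)] by fastforce

lemma submodule_Int: "\<lbrakk>submodule U R M; submodule V R M\<rbrakk> \<Longrightarrow> submodule (U \<inter> V) R M"
  by (rule submoduleI)
    (simp_all add: submoduleE(3,4,5) submodule_zero_closed le_infI1[OF submoduleE(1)])

text \<open>
  Closure under scalars gives closure under negation, which is multiplication by \<open>-1\<close>.
\<close>

lemma submoduleI_no_minus:
  assumes "H \<subseteq> carrier M" "\<zero>\<^bsub>M\<^esub> \<in> H"
    and "\<And>a b. \<lbrakk>a \<in> H; b \<in> H\<rbrakk> \<Longrightarrow> a \<oplus>\<^bsub>M\<^esub> b \<in> H"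
    and smult: "\<And>a x. \<lbrakk>a \<in> carrier R; x \<in> H\<rbrakk> \<Longrightarrow> a \<odot>\<^bsub>M\<^esub> x \<in> H"
  shows "submodule H R M"
proof (rule submoduleI)
  fix a assume a: "a \<in> H"
  have "\<ominus>\<^bsub>M\<^esub> a = (\<ominus> \<one>) \<odot>\<^bsub>M\<^esub> a"
    using a assms(1) by (simp add: smult_l_minus subsetD)
  then show "\<ominus>\<^bsub>M\<^esub> a \<in> H" using smult a by simp
qed (use assms in auto)

lemma set_add_memI: "\<lbrakk>u \<in> U; v \<in> V\<rbrakk> \<Longrightarrow> u \<oplus>\<^bsub>M\<^esub> v \<in> U <+>\<^bsub>M\<^esub> V"
  unfolding set_add_def' by blast

lemma set_add_memE:
  assumes "x \<in> U <+>\<^bsub>M\<^esub> V" obtains u v where "u \<in> U" "v \<in> V" "x = u \<oplus>\<^bsub>M\<^esub> v"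
  using assms unfolding set_add_def' by blast

lemma submodule_set_add:
  assumes "submodule U R M" "submodule V R M"
  shows "submodule (U <+>\<^bsub>M\<^esub> V) R M"
proof -
  note U = submoduleE[OF assms(1)] submodule_zero_closed[OF assms(1)]
  note V = submoduleE[OF assms(2)] submodule_zero_closed[OF assms(2)]
  have sub: "x \<in> carrier M" if "x \<in> U \<or> x \<in> V" for x using that U(1) V(1) by auto
  show ?thesis
  proof (rule submoduleI_no_minus)
    show "U <+>\<^bsub>M\<^esub> V \<subseteq> carrier M" using sub by (auto simp: set_add_def')
    have "\<zero>\<^bsub>M\<^esub> = \<zero>\<^bsub>M\<^esub> \<oplus>\<^bsub>M\<^esub> \<zero>\<^bsub>M\<^esub>" by simp
    then show "\<zero>\<^bsub>M\<^esub> \<in> U <+>\<^bsub>M\<^esub> V" using U(7) V(7) set_add_memI by metis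
    fix x y assume "x \<in> U <+>\<^bsub>M\<^esub> V" "y \<in> U <+>\<^bsub>M\<^esub> V"
    then obtain u v u' v' where uv: "u \<in> U" "v \<in> V" "x = u \<oplus>\<^bsub>M\<^esub> v" "u' \<in> U" "v' \<in> V" "y = u' \<oplus>\<^bsub>M\<^esub> v'"
      by (elim set_add_memE) blast
    have "x \<oplus>\<^bsub>M\<^esub> y = (u \<oplus>\<^bsub>M\<^esub> u') \<oplus>\<^bsub>M\<^esub> (v \<oplus>\<^bsub>M\<^esub> v')"
      using uv sub by (simp add: M.a_ac)
    then show "x \<oplus>\<^bsub>M\<^esub> y \<in> U <+>\<^bsub>M\<^esub> V"
      using set_add_memI[OF U(5)[OF uv(1,4)] V(5)[OF uv(2,5)]] by simp
  next
    fix a x assume a: "a \<in> carrier R" and "x \<in> U <+>\<^bsub>M\<^esub> V"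
    then obtain u v where uv: "u \<in> U" "v \<in> V" "x = u \<oplus>\<^bsub>M\<^esub> v"
      by (elim set_add_memE) blast
    have "a \<odot>\<^bsub>M\<^esub> x = a \<odot>\<^bsub>M\<^esub> u \<oplus>\<^bsub>M\<^esub> a \<odot>\<^bsub>M\<^esub> v"
      using uv sub a by (simp add: smult_r_distr)
    then show "a \<odot>\<^bsub>M\<^esub> x \<in> U <+>\<^bsub>M\<^esub> V"
      using set_add_memI[OF U(4)[OF a uv(1)] V(4)[OF a uv(2)]] by simp
  qed
qed

lemma finsum_mem_submodule:
  assumes "submodule H R M" "finite A" "\<And>a. a \<in> A \<Longrightarrow> f a \<in> H"
  shows "(\<Oplus>\<^bsub>M\<^esub>a\<in>A. f a) \<in> H"
  using assms(2,3)
proof (induction A)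
  case empty then show ?case by (simp add: submodule_zero_closed assms(1))
next
  case (insert x F)
  have "f a \<in> carrier M" if "a \<in> insert x F" for a
    using insert.prems[OF that] submoduleE(1)[OF assms(1)] by auto
  then show ?case
    using insert submoduleE(5)[OF assms(1)] by (simp add: Pi_def)
qed

lemma lin_span_least:
  assumes "submodule H R M" "finite A" "A \<subseteq> H"
  shows "lin_span A \<subseteq> H"
proof -
  have "(\<Oplus>\<^bsub>M\<^esub>a\<in>A. c a \<odot>\<^bsub>M\<^esub> a) \<in> H" if "c \<in> A \<rightarrow> carrier R" for c
    by (rule finsum_mem_submodule[OF assms(1,2)])
      (use that assms(3) submoduleE(4)[OF assms(1)] in auto)
  then show ?thesis by (auto simp: lin_span_def)
qed

lemma lin_span_submodule:
  assumes "finite A" "A \<subseteq> carrier M"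
  shows "submodule (lin_span A) R M"
proof (rule submoduleI_no_minus)
  show "lin_span A \<subseteq> carrier M" by (rule lin_span_least[OF carrier_is_submodule assms])
  have "(\<Oplus>\<^bsub>M\<^esub>a\<in>A. \<zero> \<odot>\<^bsub>M\<^esub> a) = (\<Oplus>\<^bsub>M\<^esub>a\<in>A. \<zero>\<^bsub>M\<^esub>)"
    by (rule M.finsum_cong') (use assms in auto)
  then have "\<zero>\<^bsub>M\<^esub> = (\<Oplus>\<^bsub>M\<^esub>a\<in>A. \<zero> \<odot>\<^bsub>M\<^esub> a)" by simp
  then show "\<zero>\<^bsub>M\<^esub> \<in> lin_span A" unfolding lin_span_def by (auto intro!: exI[of _ "\<lambda>_. \<zero>"])
  fix x y assume "x \<in> lin_span A" "y \<in> lin_span A"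
  then obtain c d where c: "c \<in> A \<rightarrow> carrier R" "x = (\<Oplus>\<^bsub>M\<^esub>a\<in>A. c a \<odot>\<^bsub>M\<^esub> a)"
    and d: "d \<in> A \<rightarrow> carrier R" "y = (\<Oplus>\<^bsub>M\<^esub>a\<in>A. d a \<odot>\<^bsub>M\<^esub> a)"
    unfolding lin_span_def by blast
  have "x \<oplus>\<^bsub>M\<^esub> y = (\<Oplus>\<^bsub>M\<^esub>a\<in>A. c a \<odot>\<^bsub>M\<^esub> a \<oplus>\<^bsub>M\<^esub> d a \<odot>\<^bsub>M\<^esub> a)"
    unfolding c(2) d(2) by (intro M.finsum_addf[symmetric] smult_fun_closed assms c d)
  also have "\<dots> = (\<Oplus>\<^bsub>M\<^esub>a\<in>A. (c a \<oplus> d a) \<odot>\<^bsub>M\<^esub> a)"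
    using assms c(1) d(1) by (intro M.finsum_cong') (auto simp: smult_l_distr Pi_iff subset_iff)
  finally show "x \<oplus>\<^bsub>M\<^esub> y \<in> lin_span A"
    unfolding lin_span_def using c(1) d(1) by (auto intro!: exI[of _ "\<lambda>a. c a \<oplus> d a"])
next
  fix r x assume r: "r \<in> carrier R" and "x \<in> lin_span A"
  then obtain c where c: "c \<in> A \<rightarrow> carrier R" "x = (\<Oplus>\<^bsub>M\<^esub>a\<in>A. c a \<odot>\<^bsub>M\<^esub> a)"
    unfolding lin_span_def by blast
  have "r \<odot>\<^bsub>M\<^esub> x = (\<Oplus>\<^bsub>M\<^esub>a\<in>A. r \<odot>\<^bsub>M\<^esub> (c a \<odot>\<^bsub>M\<^esub> a))"
    unfolding c(2) by (intro finsum_smult_ldistr smult_fun_closed assms c r)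
  also have "\<dots> = (\<Oplus>\<^bsub>M\<^esub>a\<in>A. (r \<otimes> c a) \<odot>\<^bsub>M\<^esub> a)"
    using assms c(1) r by (intro M.finsum_cong') (auto simp: smult_assoc1 Pi_iff subset_iff)
  finally show "r \<odot>\<^bsub>M\<^esub> x \<in> lin_span A"
    unfolding lin_span_def using c(1) r by (auto intro!: exI[of _ "\<lambda>a. r \<otimes> c a"])
qed

lemma lin_span_superset:
  assumes "finite A" "A \<subseteq> carrier M"
  shows "A \<subseteq> lin_span A"
proof
  fix a assume a: "a \<in> A"
  let ?c = "\<lambda>x. if a = x then \<one> else \<zero>"
  have "(\<Oplus>\<^bsub>M\<^esub>x\<in>A. ?c x \<odot>\<^bsub>M\<^esub> x) = (\<Oplus>\<^bsub>M\<^esub>x\<in>A. if a = x then x else \<zero>\<^bsub>M\<^esub>)"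
    using assms by (intro M.finsum_cong') auto
  also have "\<dots> = a"
    using M.finsum_singleton[OF a assms(1), of "\<lambda>x. x"] assms(2) by auto
  finally show "a \<in> lin_span A"
    unfolding lin_span_def by (auto intro!: exI[of _ ?c])
qed

lemma lin_span_mono:
  assumes "finite B" "A \<subseteq> B" "B \<subseteq> carrier M"
  shows "lin_span A \<subseteq> lin_span B"
  using assms lin_span_superset[OF assms(1,3)]
  by (intro lin_span_least[OF lin_span_submodule[OF assms(1,3)]]) (auto intro: finite_subset)

lemma lin_span_insert:
  assumes "finite A" "insert a A \<subseteq> carrier M" "x \<in> lin_span (insert a A)"
  obtains r w where "r \<in> carrier R" "w \<in> lin_span A" "x = r \<odot>\<^bsub>M\<^esub> a \<oplus>\<^bsub>M\<^esub> w"
proof (cases "a \<in> A")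
  case True
  then have "x \<in> lin_span A" using assms(3) by (simp add: insert_absorb)
  moreover from this have "x = \<zero> \<odot>\<^bsub>M\<^esub> a \<oplus>\<^bsub>M\<^esub> x"
    using submoduleE(1)[OF lin_span_submodule[of A]] assms by auto
  ultimately show ?thesis using that by blast
next
  case False
  obtain c where c: "c \<in> insert a A \<rightarrow> carrier R" "x = (\<Oplus>\<^bsub>M\<^esub>a\<in>insert a A. c a \<odot>\<^bsub>M\<^esub> a)"
    using assms(3) unfolding lin_span_def by blast
  have "x = c a \<odot>\<^bsub>M\<^esub> a \<oplus>\<^bsub>M\<^esub> (\<Oplus>\<^bsub>M\<^esub>a\<in>A. c a \<odot>\<^bsub>M\<^esub> a)"
    unfolding c(2) using c(1) assms(1,2) False by (intro M.finsum_insert) auto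
  moreover have "(\<Oplus>\<^bsub>M\<^esub>a\<in>A. c a \<odot>\<^bsub>M\<^esub> a) \<in> lin_span A"
    unfolding lin_span_def using c(1) by blast
  ultimately show ?thesis using that c(1) by blast
qed

definition fg_submodule where
  "fg_submodule U \<longleftrightarrow> (\<exists>A\<subseteq>U. finite A \<and> U \<subseteq> lin_span A)"

definition noetherian_submodule where
  "noetherian_submodule U \<longleftrightarrow> (\<forall>V. submodule V R M \<longrightarrow> V \<subseteq> U \<longrightarrow> fg_submodule V)"

text \<open>
  Finite generation lifts along the projection modulo \<open>W\<close>: if finitely many elements of \<open>V\<close> generate
  \<open>V\<close> up to errors in \<open>W\<close>, the errors again lie in \<open>V\<close>, hence in \<open>V \<inter> W\<close>. Both inductions that
  propagate the Noetherian property rest on this step.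
\<close>

lemma fg_submodule_extension:
  assumes V: "submodule V R M" and W: "submodule W R M"
    and F: "finite F" "F \<subseteq> V" "V \<subseteq> lin_span F <+>\<^bsub>M\<^esub> W"
    and fg: "fg_submodule (V \<inter> W)"
  shows "fg_submodule V"
proof -
  obtain B where B: "B \<subseteq> V \<inter> W" "finite B" "V \<inter> W \<subseteq> lin_span B"
    using fg unfolding fg_submodule_def by blast
  have Vc: "V \<subseteq> carrier M" using submoduleE(1)[OF V] .
  have FB: "finite (F \<union> B)" "F \<union> B \<subseteq> carrier M" using F B Vc by auto
  have "v \<in> lin_span (F \<union> B)" if v: "v \<in> V" for v
  proof -
    obtain s w where sw: "s \<in> lin_span F" "w \<in> W" "v = s \<oplus>\<^bsub>M\<^esub> w"
      using v F(3) set_add_memE by blast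
    have s: "s \<in> V" using sw(1) lin_span_least[OF V F(1,2)] by blast
    have "w = \<ominus>\<^bsub>M\<^esub> s \<oplus>\<^bsub>M\<^esub> v"
      unfolding sw(3) using s sw(2) Vc submoduleE(1)[OF W]
      by (metis M.r_neg1 subsetD)
    then have "w \<in> V" using s v submoduleE(3,5)[OF V] by auto
    then have "w \<in> lin_span (F \<union> B)" "s \<in> lin_span (F \<union> B)"
      using sw B lin_span_mono[OF FB(1) _ FB(2)] by blast+
    then show ?thesis unfolding sw(3) using submoduleE(5)[OF lin_span_submodule[OF FB]] by blast
  qed
  then show ?thesis unfolding fg_submodule_def using F(2) B(1) FB(1) by (intro exI[of _ "F \<union> B"]) auto
qed

text \<open>
  These ideals carry the Noetherian hypothesis on the ring over to modules.
\<close>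

lemma transporter_ideal:
  assumes W: "submodule W R M" and a: "a \<in> carrier M"
  shows "ideal {r \<in> carrier R. r \<odot>\<^bsub>M\<^esub> a \<in> W} R"
proof (rule idealI)
  show "ring R" by unfold_locales
  note Wc = submoduleE[OF W] submodule_zero_closed[OF W]
  show "subgroup {r \<in> carrier R. r \<odot>\<^bsub>M\<^esub> a \<in> W} (add_monoid R)"
    by (rule R.add.subgroupI) (use a Wc in \<open>auto simp: smult_l_distr smult_l_minus intro: exI[of _ \<zero>]\<close>)
next
  fix r x assume r: "r \<in> {r \<in> carrier R. r \<odot>\<^bsub>M\<^esub> a \<in> W}" and x: "x \<in> carrier R"
  then show "x \<otimes> r \<in> {r \<in> carrier R. r \<odot>\<^bsub>M\<^esub> a \<in> W}"
    using a submoduleE(4)[OF W] by (auto simp: smult_assoc1)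
  then show "r \<otimes> x \<in> {r \<in> carrier R. r \<odot>\<^bsub>M\<^esub> a \<in> W}"
    using r x by (simp add: R.m_comm)
qed

text \<open>
  Induction on the generators. Modulo the span \<open>W\<close> of the old generators, the span of
  \<open>insert a A\<close> is cyclic, so a submodule \<open>V\<close> is determined modulo \<open>W\<close> by the ideal of the \<open>r\<close> with
  \<open>r a \<in> V + W\<close>. Finitely many generators of this ideal lift to elements of \<open>V\<close> that generate \<open>V\<close>
  modulo \<open>W\<close>.
\<close>

lemma noetherian_lin_span:
  assumes R: "noetherian_ring R" and "finite A" "A \<subseteq> carrier M"
  shows "noetherian_submodule (lin_span A)"
  using assms(2,3)
proof (induction A)
  case empty
  have "lin_span {} = {\<zero>\<^bsub>M\<^esub>}" by (simp add: lin_span_def)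
  then show ?case
    unfolding noetherian_submodule_def fg_submodule_def by (intro allI impI exI[of _ "{}"]) auto
next
  case (insert a A)
  have A: "A \<subseteq> carrier M" "a \<in> carrier M" using insert.prems by auto
  let ?W = "lin_span A"
  have W: "submodule ?W R M" using insert.hyps A by (intro lin_span_submodule)
  show ?case unfolding noetherian_submodule_def
  proof (intro allI impI)
    fix V assume V: "submodule V R M" and sub: "V \<subseteq> lin_span (insert a A)"
    note Vc = submoduleE(1)[OF V] and Wc = submoduleE(1)[OF W]
    let ?I = "\<lambda>V. {r \<in> carrier R. r \<odot>\<^bsub>M\<^esub> a \<in> V <+>\<^bsub>M\<^esub> ?W}"
    have "ideal (?I V) R" by (rule transporter_ideal[OF submodule_set_add[OF V W] A(2)])
    then obtain T where T: "T \<subseteq> carrier R" "finite T" "?I V = Idl T"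
      using noetherian_ring.finetely_gen[OF R] by blast
    have "\<forall>t\<in>T. \<exists>v\<in>V. \<exists>w\<in>?W. t \<odot>\<^bsub>M\<^esub> a = v \<oplus>\<^bsub>M\<^esub> w"
      using R.genideal_self[OF T(1)] T(3) set_add_memE by blast
    then obtain v where v: "\<And>t. t \<in> T \<Longrightarrow> v t \<in> V \<and> (\<exists>w\<in>?W. t \<odot>\<^bsub>M\<^esub> a = v t \<oplus>\<^bsub>M\<^esub> w)"
      by metis
    let ?F = "v ` T"
    have F: "finite ?F" "?F \<subseteq> V" using T v by auto
    have Fc: "?F \<subseteq> carrier M" using F Vc by blast
    have F': "submodule (lin_span ?F) R M" using lin_span_submodule[OF F(1) Fc] .
    have id: "ideal (?I (lin_span ?F)) R"
      by (rule transporter_ideal[OF submodule_set_add[OF F' W] A(2)])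
    have "T \<subseteq> ?I (lin_span ?F)"
    proof
      fix t assume t: "t \<in> T"
      then obtain w where "w \<in> ?W" "t \<odot>\<^bsub>M\<^esub> a = v t \<oplus>\<^bsub>M\<^esub> w" using v by blast
      moreover have "v t \<in> lin_span ?F" using lin_span_superset[OF F(1) Fc] t by blast
      ultimately show "t \<in> ?I (lin_span ?F)" using t T(1) set_add_memI by auto
    qed
    then have I: "?I V \<subseteq> ?I (lin_span ?F)" unfolding T(3) by (rule R.genideal_minimal[OF id])
    show "fg_submodule V"
    proof (rule fg_submodule_extension[OF V W F])
      show "V \<subseteq> lin_span ?F <+>\<^bsub>M\<^esub> ?W"
      proof
        fix x assume x: "x \<in> V"
        obtain r w where rw: "r \<in> carrier R" "w \<in> ?W" "x = r \<odot>\<^bsub>M\<^esub> a \<oplus>\<^bsub>M\<^esub> w"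
          by (rule lin_span_insert[OF insert.hyps(1) insert.prems subsetD[OF sub x]])
        have "r \<odot>\<^bsub>M\<^esub> a = x \<oplus>\<^bsub>M\<^esub> \<ominus>\<^bsub>M\<^esub> w"
          unfolding rw(3) using rw A(2) Wc by (simp add: M.a_assoc M.r_neg subset_iff)
        then have "r \<in> ?I V"
          using rw(1) set_add_memI[OF x submoduleE(3)[OF W rw(2)]] by simp
        then have "r \<odot>\<^bsub>M\<^esub> a \<in> lin_span ?F <+>\<^bsub>M\<^esub> ?W" using I by blast
        then show "x \<in> lin_span ?F <+>\<^bsub>M\<^esub> ?W"
          unfolding rw(3)
          by (rule submoduleE(5)[OF submodule_set_add[OF F' W]])
            (use set_add_memI[OF submodule_zero_closed[OF F'] rw(2)] rw(2) Wc in auto)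
      qed
      have "submodule (V \<inter> ?W) R M" by (rule submodule_Int[OF V W])
      then show "fg_submodule (V \<inter> ?W)"
        using insert.IH[OF A(1)] unfolding noetherian_submodule_def by blast
    qed
  qed
qed

end

lemma (in module) finite_module_iff_fg_submodule:
  "finite_module R M \<longleftrightarrow> fg_submodule (carrier M)"
proof -
  have "(\<forall>x\<in>carrier M. \<exists>c\<in>A \<rightarrow> carrier R. x = (\<Oplus>\<^bsub>M\<^esub>a\<in>A. c a \<odot>\<^bsub>M\<^esub> a))
      \<longleftrightarrow> carrier M \<subseteq> lin_span A" for A
    by (simp only: lin_span_def subset_iff mem_Collect_eq Ball_def Bex_def conj_commute)
  then show ?thesis
    by (simp add: finite_module_def finite_module_axioms_def module_axioms fg_submodule_def)
qed

lemma (in finite_module) noetherian_carrier: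
  assumes "noetherian_ring R"
  shows "noetherian_submodule (carrier M)"
proof -
  have "fg_submodule (carrier M)" using finite_module_axioms by (simp add: finite_module_iff_fg_submodule)
  then obtain A where A: "finite A" "A \<subseteq> carrier M" "carrier M \<subseteq> lin_span A"
    unfolding fg_submodule_def by (elim exE conjE)
  have "lin_span A = carrier M"
    using A(3) lin_span_least[OF carrier_is_submodule A(1,2)] by (rule subset_antisym[rotated])
  then show ?thesis using noetherian_lin_span[OF assms A(1,2)] by simp
qed

lemma (in module) noetherian_imp_fg_submodule:
  "\<lbrakk>noetherian_submodule U; submodule V R M; V \<subseteq> U\<rbrakk> \<Longrightarrow> fg_submodule V"
  unfolding noetherian_submodule_def by blast

section \<open>Linear maps\<close>

locale linear_map = H: module R H + N: module R N
  for R :: "('a, 'c) ring_scheme" and H :: "('a, 'h, 'd) module_scheme"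
    and N :: "('a, 'n, 'e) module_scheme" +
  fixes f
  assumes map_closed [simp, intro]: "x \<in> carrier H \<Longrightarrow> f x \<in> carrier N"
    and map_add: "\<lbrakk>x \<in> carrier H; y \<in> carrier H\<rbrakk> \<Longrightarrow> f (x \<oplus>\<^bsub>H\<^esub> y) = f x \<oplus>\<^bsub>N\<^esub> f y"
    and map_smult: "\<lbrakk>a \<in> carrier R; x \<in> carrier H\<rbrakk> \<Longrightarrow> f (a \<odot>\<^bsub>H\<^esub> x) = a \<odot>\<^bsub>N\<^esub> f x"
begin

lemma map_zero [simp]: "f \<zero>\<^bsub>H\<^esub> = \<zero>\<^bsub>N\<^esub>"
  using map_smult[of "\<zero>\<^bsub>R\<^esub>" "\<zero>\<^bsub>H\<^esub>"] by simp

lemma map_minus: "x \<in> carrier H \<Longrightarrow> f (\<ominus>\<^bsub>H\<^esub> x) = \<ominus>\<^bsub>N\<^esub> f x"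
  using map_smult[of "\<ominus>\<^bsub>R\<^esub> \<one>\<^bsub>R\<^esub>" x] by (simp add: H.smult_l_minus N.smult_l_minus)

lemma image_submodule:
  assumes "submodule V R H"
  shows "submodule (f ` V) R N"
proof -
  note V = H.submoduleE[OF assms] H.submodule_zero_closed[OF assms]
  show ?thesis
  proof (rule N.submoduleI_no_minus)
    show "f ` V \<subseteq> carrier N" using V(1) by auto
    show "\<zero>\<^bsub>N\<^esub> \<in> f ` V" using V(7) by (intro image_eqI[of _ f "\<zero>\<^bsub>H\<^esub>"]) auto
  next
    fix a b assume "a \<in> f ` V" "b \<in> f ` V"
    then obtain x y where "x \<in> V" "y \<in> V" "a = f x" "b = f y" by blast
    then show "a \<oplus>\<^bsub>N\<^esub> b \<in> f ` V"
      using V(1,5) by (intro image_eqI[of _ f "x \<oplus>\<^bsub>H\<^esub> y"]) (auto simp: map_add subset_iff)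
  next
    fix r a assume r: "r \<in> carrier R" and "a \<in> f ` V"
    then obtain x where "x \<in> V" "a = f x" by blast
    then show "r \<odot>\<^bsub>N\<^esub> a \<in> f ` V"
      using r V(1,4) by (intro image_eqI[of _ f "r \<odot>\<^bsub>H\<^esub> x"]) (auto simp: map_smult subset_iff)
  qed
qed

lemma preimage_submodule:
  assumes "submodule U R H" "submodule V R N"
  shows "submodule {x \<in> U. f x \<in> V} R H"
proof -
  note U = H.submoduleE[OF assms(1)] H.submodule_zero_closed[OF assms(1)]
  note V = N.submoduleE[OF assms(2)] N.submodule_zero_closed[OF assms(2)]
  show ?thesis
    by (rule H.submoduleI_no_minus) (use U V in \<open>auto simp: map_add map_smult subset_iff\<close>)
qed

lemma kernel_submodule:
  assumes "submodule U R H"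
  shows "submodule {x \<in> U. f x = \<zero>\<^bsub>N\<^esub>} R H"
proof -
  have "submodule {\<zero>\<^bsub>N\<^esub>} R N" by (rule N.submoduleI_no_minus) auto
  from preimage_submodule[OF assms this] show ?thesis by simp
qed

lemma image_lin_span:
  assumes "finite A" "A \<subseteq> carrier H"
  shows "f ` H.lin_span A = N.lin_span (f ` A)"
proof
  have fA: "finite (f ` A)" "f ` A \<subseteq> carrier N" using assms by auto
  have "H.lin_span A \<subseteq> {x \<in> carrier H. f x \<in> N.lin_span (f ` A)}"
    using N.lin_span_superset[OF fA] assms
    by (intro H.lin_span_least preimage_submodule H.carrier_is_submodule N.lin_span_submodule fA) auto
  then show "f ` H.lin_span A \<subseteq> N.lin_span (f ` A)" by blast
  show "N.lin_span (f ` A) \<subseteq> f ` H.lin_span A"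
    using H.lin_span_superset[OF assms]
    by (intro N.lin_span_least image_submodule H.lin_span_submodule assms fA) auto
qed

lemma fg_submodule_image:
  assumes "H.fg_submodule U" "U \<subseteq> carrier H"
  shows "N.fg_submodule (f ` U)"
proof -
  obtain A where A: "A \<subseteq> U" "finite A" "U \<subseteq> H.lin_span A"
    using assms(1) unfolding H.fg_submodule_def by blast
  have "A \<subseteq> carrier H" using A(1) assms(2) by (rule subset_trans)
  then have "f ` U \<subseteq> N.lin_span (f ` A)"
    using image_mono[OF A(3), of f] by (simp add: image_lin_span A(2))
  then show ?thesis
    unfolding N.fg_submodule_def using A(1,2) by (intro exI[of _ "f ` A"]) auto
qed

text \<open>
  The lifts of generators of the image of \<open>V\<close> generate \<open>V\<close> modulo the kernel.
\<close>

lemma noetherian_submodule_if_kernel_and_codomain: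
  assumes U: "submodule U R H"
    and N: "N.noetherian_submodule (carrier N)"
    and ker: "H.noetherian_submodule {x \<in> U. f x = \<zero>\<^bsub>N\<^esub>}"
  shows "H.noetherian_submodule U"
  unfolding H.noetherian_submodule_def
proof (intro allI impI)
  fix V assume V: "submodule V R H" and VU: "V \<subseteq> U"
  let ?W = "{x \<in> U. f x = \<zero>\<^bsub>N\<^esub>}"
  note Vc = H.submoduleE[OF V]
  have W: "submodule ?W R H" by (rule kernel_submodule[OF U])
  have "N.fg_submodule (f ` V)"
    by (rule N.noetherian_imp_fg_submodule[OF N image_submodule[OF V]]) (use Vc(1) in auto)
  then obtain B where B: "B \<subseteq> f ` V" "finite B" "f ` V \<subseteq> N.lin_span B"
    unfolding N.fg_submodule_def by blast
  then obtain F where F: "F \<subseteq> V" "finite F" "B = f ` F" by (meson finite_subset_image)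
  have "F \<subseteq> carrier H" using F(1) Vc(1) by (rule subset_trans)
  then have span: "f ` V \<subseteq> f ` H.lin_span F"
    using B(3) F(2) by (simp add: F(3) image_lin_span)
  show "H.fg_submodule V"
  proof (rule H.fg_submodule_extension[OF V W F(2,1)])
    show "V \<subseteq> H.lin_span F <+>\<^bsub>H\<^esub> ?W"
    proof
      fix v assume v: "v \<in> V"
      obtain s where s: "s \<in> H.lin_span F" "f v = f s"
        using subsetD[OF span imageI[OF v]] by (rule imageE) simp
      have sV: "s \<in> V" using s(1) H.lin_span_least[OF V F(2,1)] by blast
      let ?w = "\<ominus>\<^bsub>H\<^esub> s \<oplus>\<^bsub>H\<^esub> v"
      have c: "s \<in> carrier H" "v \<in> carrier H" using sV v Vc(1) by auto
      have "?w \<in> V" using v sV Vc(3,5) by blast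
      moreover have "f ?w = \<zero>\<^bsub>N\<^esub>" using c s(2) by (simp add: map_add map_minus N.M.l_neg)
      ultimately have "?w \<in> ?W" using VU by auto
      moreover have "v = s \<oplus>\<^bsub>H\<^esub> ?w" using c by (simp add: H.M.r_neg2)
      ultimately show "v \<in> H.lin_span F <+>\<^bsub>H\<^esub> ?W" using H.set_add_memI[OF s(1), of ?w ?W] by simp
    qed
    show "H.fg_submodule (V \<inter> ?W)"
      by (rule H.noetherian_imp_fg_submodule[OF ker H.submodule_Int[OF V W]]) auto
  qed
qed

end

section \<open>Quotient modules\<close>

context module
begin

text \<open>
  The scalar multiple of a coset is defined as a union over its members; all the members of the union
  coincide, so the quotient can be computed on representatives.
\<close>

lemma quotient_coset_simps:
  assumes "submodule N R M"
  shows "carrier (quotient_module M N) = (\<lambda>x. N +>\<^bsub>M\<^esub> x) ` carrier M"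
    and "\<And>x y. \<lbrakk>x \<in> carrier M; y \<in> carrier M\<rbrakk> \<Longrightarrow>
      (N +>\<^bsub>M\<^esub> x) \<oplus>\<^bsub>quotient_module M N\<^esub> (N +>\<^bsub>M\<^esub> y) = N +>\<^bsub>M\<^esub> (x \<oplus>\<^bsub>M\<^esub> y)"
    and "\<And>a x. \<lbrakk>a \<in> carrier R; x \<in> carrier M\<rbrakk> \<Longrightarrow>
      a \<odot>\<^bsub>quotient_module M N\<^esub> (N +>\<^bsub>M\<^esub> x) = N +>\<^bsub>M\<^esub> (a \<odot>\<^bsub>M\<^esub> x)"
    and "\<zero>\<^bsub>quotient_module M N\<^esub> = N +>\<^bsub>M\<^esub> \<zero>\<^bsub>M\<^esub>"
proof -
  note N = submoduleE[OF assms] submodule_zero_closed[OF assms]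
  interpret abelian_subgroup N M
    by (intro abelian_subgroupI3 additive_subgroup.intro submodule.axioms(1)[OF assms] abelian_group_axioms)
  show "carrier (quotient_module M N) = (\<lambda>x. N +>\<^bsub>M\<^esub> x) ` carrier M"
    by (auto simp: quotient_module_def A_RCOSETS_def')
  show "(N +>\<^bsub>M\<^esub> x) \<oplus>\<^bsub>quotient_module M N\<^esub> (N +>\<^bsub>M\<^esub> y) = N +>\<^bsub>M\<^esub> (x \<oplus>\<^bsub>M\<^esub> y)"
    if "x \<in> carrier M" "y \<in> carrier M" for x y
    using that by (simp add: quotient_module_def a_rcos_sum)
  show "\<zero>\<^bsub>quotient_module M N\<^esub> = N +>\<^bsub>M\<^esub> \<zero>\<^bsub>M\<^esub>"
    using N(1) by (simp add: quotient_module_def)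
  show "a \<odot>\<^bsub>quotient_module M N\<^esub> (N +>\<^bsub>M\<^esub> x) = N +>\<^bsub>M\<^esub> (a \<odot>\<^bsub>M\<^esub> x)"
    if a: "a \<in> carrier R" and x: "x \<in> carrier M" for a x
  proof -
    have eq: "N +>\<^bsub>M\<^esub> (a \<odot>\<^bsub>M\<^esub> y) = N +>\<^bsub>M\<^esub> (a \<odot>\<^bsub>M\<^esub> x)" if y: "y \<in> N +>\<^bsub>M\<^esub> x" for y
    proof -
      obtain n where n: "n \<in> N" "y = n \<oplus>\<^bsub>M\<^esub> x" using y by (auto simp: a_r_coset_def')
      have "a \<odot>\<^bsub>M\<^esub> y = a \<odot>\<^bsub>M\<^esub> n \<oplus>\<^bsub>M\<^esub> a \<odot>\<^bsub>M\<^esub> x"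
        unfolding n(2) using n(1) N(1) a x by (intro smult_r_distr) auto
      then have "a \<odot>\<^bsub>M\<^esub> y \<in> N +>\<^bsub>M\<^esub> (a \<odot>\<^bsub>M\<^esub> x)"
        using N(4)[OF a n(1)] by (auto simp: a_r_coset_def')
      from a_repr_independence[OF this smult_closed[OF a x] submodule.axioms(1)[OF assms]]
      show ?thesis by (rule sym)
    qed
    have "N +>\<^bsub>M\<^esub> x \<noteq> {}" using a_rcos_self[OF x] by blast
    then have "(\<Union>y\<in>N +>\<^bsub>M\<^esub> x. N +>\<^bsub>M\<^esub> (a \<odot>\<^bsub>M\<^esub> y)) = N +>\<^bsub>M\<^esub> (a \<odot>\<^bsub>M\<^esub> x)"
      by (rule SUP_eq_const[OF _ eq])
    then show ?thesis by (simp add: quotient_module_def)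
  qed
qed

lemma quotient_module_is_module:
  assumes "submodule N R M"
  shows "module R (quotient_module M N)"
proof -
  note q = quotient_coset_simps[OF assms]
  show ?thesis
  proof (rule moduleI)
    show "cring R" by (rule R.is_cring)
    show "abelian_group (quotient_module M N)"
    proof (rule abelian_groupI)
      fix X assume "X \<in> carrier (quotient_module M N)"
      then obtain x where x: "x \<in> carrier M" "X = N +>\<^bsub>M\<^esub> x" by (auto simp: q(1))
      show "\<exists>Y\<in>carrier (quotient_module M N). Y \<oplus>\<^bsub>quotient_module M N\<^esub> X = \<zero>\<^bsub>quotient_module M N\<^esub>"
        using x by (intro bexI[of _ "N +>\<^bsub>M\<^esub> (\<ominus>\<^bsub>M\<^esub> x)"]) (auto simp: q M.l_neg)
    qed (auto simp: q M.a_ac)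
  qed (auto simp: q smult_l_distr smult_r_distr smult_assoc1)
qed

lemma finite_quotient_module:
  assumes "fg_submodule (carrier M)" "submodule N R M"
  shows "finite_module R (quotient_module M N)"
proof -
  note q = quotient_coset_simps[OF assms(2)]
  interpret Q: module R "quotient_module M N" by (rule quotient_module_is_module[OF assms(2)])
  interpret linear_map R M "quotient_module M N" "\<lambda>x. N +>\<^bsub>M\<^esub> x"
    by unfold_locales (auto simp: q)
  show ?thesis
    using fg_submodule_image[OF assms(1)] by (simp add: Q.finite_module_iff_fg_submodule q(1))
qed

end

context linear_map
begin

lemma map_finsum:
  assumes "finite A" "g \<in> A \<rightarrow> carrier H"
  shows "f (\<Oplus>\<^bsub>H\<^esub>i\<in>A. g i) = (\<Oplus>\<^bsub>N\<^esub>i\<in>A. f (g i))"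
  using assms
proof (induction A)
  case empty then show ?case by simp
next
  case (insert a A)
  have "g \<in> A \<rightarrow> carrier H" "g a \<in> carrier H" "(\<lambda>i. f (g i)) \<in> A \<rightarrow> carrier N" "f (g a) \<in> carrier N"
    using insert.prems by auto
  then show ?case using insert by (simp add: map_add)
qed

end

text \<open>
  A finite sum of submodules, in the shape in which \<^const>\<open>transfer_sum\<close> presents the sum of the
  images of transfer.
\<close>

lemma (in module) submodule_finsum:
  assumes "finite X" "\<And>P. P \<in> X \<Longrightarrow> submodule (T P) R M"
  shows "submodule {\<Oplus>\<^bsub>M\<^esub>P\<in>X. t P | t. t \<in> (\<Pi> P\<in>X. T P)} R M"
proof -
  have c: "t \<in> X \<rightarrow> carrier M" if "t \<in> (\<Pi> P\<in>X. T P)" for t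
    using that submoduleE(1)[OF assms(2)] by (auto simp: Pi_def)
  show ?thesis
  proof (rule submoduleI_no_minus)
    show "{\<Oplus>\<^bsub>M\<^esub>P\<in>X. t P | t. t \<in> (\<Pi> P\<in>X. T P)} \<subseteq> carrier M"
      using c by auto
    have "(\<Oplus>\<^bsub>M\<^esub>P\<in>X. \<zero>\<^bsub>M\<^esub>) = \<zero>\<^bsub>M\<^esub>" by simp
    then show "\<zero>\<^bsub>M\<^esub> \<in> {\<Oplus>\<^bsub>M\<^esub>P\<in>X. t P | t. t \<in> (\<Pi> P\<in>X. T P)}"
      using submodule_zero_closed[OF assms(2)] by (auto intro!: exI[of _ "\<lambda>_. \<zero>\<^bsub>M\<^esub>"])
    fix x y assume "x \<in> {\<Oplus>\<^bsub>M\<^esub>P\<in>X. t P | t. t \<in> (\<Pi> P\<in>X. T P)}" "y \<in> {\<Oplus>\<^bsub>M\<^esub>P\<in>X. t P | t. t \<in> (\<Pi> P\<in>X. T P)}"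
    then obtain t u where t: "t \<in> (\<Pi> P\<in>X. T P)" "x = (\<Oplus>\<^bsub>M\<^esub>P\<in>X. t P)"
      and u: "u \<in> (\<Pi> P\<in>X. T P)" "y = (\<Oplus>\<^bsub>M\<^esub>P\<in>X. u P)" by blast
    have "x \<oplus>\<^bsub>M\<^esub> y = (\<Oplus>\<^bsub>M\<^esub>P\<in>X. t P \<oplus>\<^bsub>M\<^esub> u P)"
      unfolding t(2) u(2) by (intro M.finsum_addf[symmetric] c t u)
    moreover have "(\<lambda>P. t P \<oplus>\<^bsub>M\<^esub> u P) \<in> (\<Pi> P\<in>X. T P)"
      using t(1) u(1) submoduleE(5)[OF assms(2)] by (auto simp: Pi_def)
    ultimately show "x \<oplus>\<^bsub>M\<^esub> y \<in> {\<Oplus>\<^bsub>M\<^esub>P\<in>X. t P | t. t \<in> (\<Pi> P\<in>X. T P)}" by blast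
  next
    fix r x assume r: "r \<in> carrier R" and "x \<in> {\<Oplus>\<^bsub>M\<^esub>P\<in>X. t P | t. t \<in> (\<Pi> P\<in>X. T P)}"
    then obtain t where t: "t \<in> (\<Pi> P\<in>X. T P)" "x = (\<Oplus>\<^bsub>M\<^esub>P\<in>X. t P)" by blast
    have "r \<odot>\<^bsub>M\<^esub> x = (\<Oplus>\<^bsub>M\<^esub>P\<in>X. r \<odot>\<^bsub>M\<^esub> t P)"
      unfolding t(2) by (intro finsum_smult_ldistr assms(1) c t r)
    moreover have "(\<lambda>P. r \<odot>\<^bsub>M\<^esub> t P) \<in> (\<Pi> P\<in>X. T P)"
      using t(1) r submoduleE(4)[OF assms(2)] by (auto simp: Pi_def)
    ultimately show "r \<odot>\<^bsub>M\<^esub> x \<in> {\<Oplus>\<^bsub>M\<^esub>P\<in>X. t P | t. t \<in> (\<Pi> P\<in>X. T P)}" by blast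
  qed
qed

section \<open>Equivariant linear maps\<close>

context group_module
begin

lemma act_closed [simp, intro]: "\<lbrakk>g \<in> carrier G; x \<in> carrier M\<rbrakk> \<Longrightarrow> act M g x \<in> carrier M"
  using action.element_image by blast

lemma act_mult: "\<lbrakk>g \<in> carrier G; h \<in> carrier G; x \<in> carrier M\<rbrakk>
    \<Longrightarrow> act M (g \<otimes>\<^bsub>G\<^esub> h) x = act M g (act M h x)"
  using action.composition_rule by blast

lemma act_one [simp]: "x \<in> carrier M \<Longrightarrow> act M \<one>\<^bsub>G\<^esub> x = x"
  using action.id_eq_one by (metis restrict_apply')

lemma is_group: "group G"
  using action.group_hom by (simp add: group_hom_def)

lemma act_linear_map: "g \<in> carrier G \<Longrightarrow> linear_map K M M (act M g)"
  by unfold_locales (auto simp: act_add act_smult)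

end

lemma restrict_scalars_simps [simp]:
  "carrier (restrict_scalars R S) = carrier S"
  "x \<oplus>\<^bsub>restrict_scalars R S\<^esub> y = x \<oplus>\<^bsub>S\<^esub> y"
  "\<zero>\<^bsub>restrict_scalars R S\<^esub> = \<zero>\<^bsub>S\<^esub>"
  "c \<odot>\<^bsub>restrict_scalars R S\<^esub> x = (c \<odot>\<^bsub>R\<^esub> \<one>\<^bsub>R\<^esub>) \<odot>\<^bsub>S\<^esub> x"
  "act (restrict_scalars R S) = act S"
  by (simp_all add: restrict_scalars_def)

lemma finsum_restrict_scalars [simp]: "finsum (restrict_scalars R S) = finsum S"
  by (intro ext) (simp add: finsum_def finprod_def restrict_scalars_def)

text \<open>
  The scalar \<open>a\<close> of \<open>k\<close> acts through the element \<open>a 1\<close> of \<open>R\<close>, and \<open>a \<mapsto> a 1\<close> is multiplicative by the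
  algebra axiom.
\<close>

lemma restrict_scalars_group_module:
  assumes "algebra k R" "group_module R G S"
  shows "group_module k G (restrict_scalars R S)"
proof -
  interpret R: algebra k R by fact
  interpret S: group_module R G S by fact
  have one_smult: "a \<odot>\<^bsub>R\<^esub> r = (a \<odot>\<^bsub>R\<^esub> \<one>\<^bsub>R\<^esub>) \<otimes>\<^bsub>R\<^esub> r" if "a \<in> carrier k" "r \<in> carrier R" for a r
    using that R.smult_assoc2[of a "\<one>\<^bsub>R\<^esub>" r] by simp
  have mod: "module k (restrict_scalars R S)"
  proof (rule moduleI)
    show "cring k" by (rule R.R_cring)
    show "abelian_group (restrict_scalars R S)"
    proof (rule abelian_groupI)
      fix x assume "x \<in> carrier (restrict_scalars R S)"
      then show "\<exists>y\<in>carrier (restrict_scalars R S).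
          y \<oplus>\<^bsub>restrict_scalars R S\<^esub> x = \<zero>\<^bsub>restrict_scalars R S\<^esub>"
        by (intro bexI[of _ "\<ominus>\<^bsub>S\<^esub> x"]) (auto simp: S.M.l_neg)
    qed (auto simp: S.M.a_ac)
  next
    fix a b x assume ab: "a \<in> carrier k" "b \<in> carrier k" and x: "x \<in> carrier (restrict_scalars R S)"
    have "(a \<otimes>\<^bsub>k\<^esub> b) \<odot>\<^bsub>R\<^esub> \<one>\<^bsub>R\<^esub> = (a \<odot>\<^bsub>R\<^esub> \<one>\<^bsub>R\<^esub>) \<otimes>\<^bsub>R\<^esub> (b \<odot>\<^bsub>R\<^esub> \<one>\<^bsub>R\<^esub>)"
      using ab by (simp add: R.smult_assoc1 one_smult[symmetric])
    then show "(a \<otimes>\<^bsub>k\<^esub> b) \<odot>\<^bsub>restrict_scalars R S\<^esub> x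
        = a \<odot>\<^bsub>restrict_scalars R S\<^esub> (b \<odot>\<^bsub>restrict_scalars R S\<^esub> x)"
      using ab x by (simp add: S.smult_assoc1)
  qed (auto simp: R.smult_l_distr S.smult_l_distr S.smult_r_distr)
  show ?thesis
    using S.action.group_action_axioms mod
    by (intro group_module.intro group_module_axioms.intro) (auto simp: S.act_add S.act_smult)
qed

locale group_module_pair = M: group_module k G M + N: group_module k G N
  for k :: "('k, 'c) ring_scheme" and G :: "('g, 'd) monoid_scheme"
    and M :: "('k, 'm, 'g) gmodule" and N :: "('k, 'n, 'g) gmodule"
begin

lemma Hom_over_linear_map: "f \<in> Hom_over k P M N \<Longrightarrow> linear_map k M N f"
  by unfold_locales (auto simp: Hom_over_def)

lemma Hom_over_act: "\<lbrakk>f \<in> Hom_over k P M N; g \<in> P; x \<in> carrier M\<rbrakk> \<Longrightarrow> f (act M g x) = act N g (f x)"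
  by (auto simp: Hom_over_def)

lemma Hom_over_extensional: "f \<in> Hom_over k P M N \<Longrightarrow> f \<in> extensional (carrier M)"
  by (simp add: Hom_over_def PiE_def)

lemma Hom_over_closed: "\<lbrakk>f \<in> Hom_over k P M N; x \<in> carrier M\<rbrakk> \<Longrightarrow> f x \<in> carrier N"
  by (auto simp: Hom_over_def)

lemma Hom_overI:
  assumes "linear_map k M N f" "\<And>g x. \<lbrakk>g \<in> P; x \<in> carrier M\<rbrakk> \<Longrightarrow> f (act M g x) = act N g (f x)"
    and "P \<subseteq> carrier G"
  shows "restrict f (carrier M) \<in> Hom_over k P M N"
proof -
  interpret linear_map k M N f by fact
  show ?thesis using assms(2,3) by (auto simp: Hom_over_def map_add map_smult subset_iff)
qed

lemma Hom_over_add: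
  assumes P: "P \<subseteq> carrier G" and f: "f \<in> Hom_over k P M N" and f': "f' \<in> Hom_over k P M N"
  shows "(\<lambda>x\<in>carrier M. f x \<oplus>\<^bsub>N\<^esub> f' x) \<in> Hom_over k P M N"
proof (rule Hom_overI[OF _ _ P])
  interpret f: linear_map k M N f by (rule Hom_over_linear_map[OF f])
  interpret f': linear_map k M N f' by (rule Hom_over_linear_map[OF f'])
  show "linear_map k M N (\<lambda>x. f x \<oplus>\<^bsub>N\<^esub> f' x)"
    by unfold_locales (auto simp: f.map_add f'.map_add f.map_smult f'.map_smult N.smult_r_distr N.M.a_ac)
  fix g x assume "g \<in> P" "x \<in> carrier M"
  then show "f (act M g x) \<oplus>\<^bsub>N\<^esub> f' (act M g x) = act N g (f x \<oplus>\<^bsub>N\<^esub> f' x)"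
    using P by (auto simp: Hom_over_act[OF f] Hom_over_act[OF f'] N.act_add)
qed

lemma Hom_over_zero:
  assumes P: "P \<subseteq> carrier G"
  shows "(\<lambda>x\<in>carrier M. \<zero>\<^bsub>N\<^esub>) \<in> Hom_over k P M N"
proof (rule Hom_overI[OF _ _ P])
  show "linear_map k M N (\<lambda>x. \<zero>\<^bsub>N\<^esub>)" by unfold_locales auto
  fix g x assume "g \<in> P"
  then show "\<zero>\<^bsub>N\<^esub> = act N g \<zero>\<^bsub>N\<^esub>"
    using linear_map.map_zero[OF N.act_linear_map] P by auto
qed

end

lemma Hom_over_compose:
  assumes "group_module_pair k G L M" "group_module_pair k G M N" and P: "P \<subseteq> Q" "P \<subseteq> carrier G"
    and f: "f \<in> Hom_over k P L M" and h: "h \<in> Hom_over k Q M N"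
  shows "compose (carrier L) h f \<in> Hom_over k P L N"
proof -
  interpret A: group_module_pair k G L M by fact
  interpret B: group_module_pair k G M N by fact
  interpret C: group_module_pair k G L N by unfold_locales
  interpret f: linear_map k L M f by (rule A.Hom_over_linear_map[OF f])
  interpret h: linear_map k M N h by (rule B.Hom_over_linear_map[OF h])
  have "linear_map k L N (\<lambda>x. h (f x))"
    by unfold_locales (auto simp: f.map_add h.map_add f.map_smult h.map_smult)
  then show ?thesis unfolding compose_def
    by (rule C.Hom_overI) (use P in \<open>auto simp: A.Hom_over_act[OF f] B.Hom_over_act[OF h]\<close>)
qed

section \<open>The transfer\<close>

text \<open>
  The summand \<open>g f g\<^sup>-\<^sup>1\<close> of the transfer, evaluated at \<open>x\<close>, for the chosen representative \<open>g\<close> of the coset \<open>C\<close>.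
\<close>

definition conjugate where
  "conjugate G M N f C x = (let g = SOME g. g \<in> C in act N g (f (act M (inv\<^bsub>G\<^esub> g) x)))"

lemma transfer_conjugate:
  "transfer G P M N f = (\<lambda>x\<in>carrier M. \<Oplus>\<^bsub>N\<^esub>C\<in>lcosets\<^bsub>G\<^esub> P. conjugate G M N f C x)"
  by (simp add: transfer_def conjugate_def)

text \<open>
  Left translation permutes the left cosets; this reindexing makes transfers equivariant.
\<close>

lemma (in group) l_coset_translation:
  assumes P: "subgroup P G" and h: "h \<in> carrier G"
  shows "inj_on (\<lambda>C. h <# C) (lcosets P)" and "(\<lambda>C. h <# C) ` (lcosets P) = lcosets P"
proof -
  have Pc: "P \<subseteq> carrier G" using P by (rule subgroup.subset)
  have tr: "g <# (a <# P) = (g \<otimes> a) <# P" if "g \<in> carrier G" "a \<in> carrier G" for g a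
    using lcos_m_assoc[OF Pc that] .
  have inv: "inv g <# (g <# C) = C" if g: "g \<in> carrier G" and C: "C \<in> lcosets P" for g C
  proof -
    obtain a where a: "a \<in> carrier G" "C = a <# P" using C by (auto simp: LCOSETS_def)
    then show ?thesis using g by (simp add: tr m_assoc[symmetric])
  qed
  have closed: "g <# C \<in> lcosets P" if g: "g \<in> carrier G" and C: "C \<in> lcosets P" for g C
  proof -
    obtain a where a: "a \<in> carrier G" "C = a <# P" using C by (auto simp: LCOSETS_def)
    then show ?thesis using g by (auto simp: tr LCOSETS_def)
  qed
  show "inj_on (\<lambda>C. h <# C) (lcosets P)" by (rule inj_on_inverseI) (rule inv[OF h])
  show "(\<lambda>C. h <# C) ` (lcosets P) = lcosets P"
  proof
    show "(\<lambda>C. h <# C) ` (lcosets P) \<subseteq> lcosets P" using closed[OF h] by blast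
    show "lcosets P \<subseteq> (\<lambda>C. h <# C) ` (lcosets P)"
    proof
      fix C assume C: "C \<in> lcosets P"
      have "C = h <# (inv h <# C)" using inv[OF inv_closed[OF h] C] h by simp
      then show "C \<in> (\<lambda>C. h <# C) ` (lcosets P)" using closed[OF inv_closed[OF h] C] by blast
    qed
  qed
qed

context group_module_pair
begin

text \<open>
  A representative \<open>g p\<close> with \<open>p \<in> P\<close> gives the same conjugate as \<open>g\<close>, because \<open>f\<close> commutes
  with \<open>p\<close>. Hence the choice made in the definition of the transfer can be replaced by any other.
\<close>

lemma conjugate_eq:
  assumes P: "subgroup P G" and f: "f \<in> Hom_over k P M N"
    and C: "C \<in> lcosets\<^bsub>G\<^esub> P" "g \<in> C" and x: "x \<in> carrier M"
  shows "conjugate G M N f C x = act N g (f (act M (inv\<^bsub>G\<^esub> g) x))"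
proof -
  interpret G: group G by (rule M.is_group)
  interpret P: subgroup P G by fact
  obtain a where a: "a \<in> carrier G" "C = a <#\<^bsub>G\<^esub> P" using C by (auto simp: LCOSETS_def)
  let ?s = "SOME g. g \<in> C"
  have s: "?s \<in> C" using C(2) by (rule someI)
  have indep: "act N h (f (act M (inv\<^bsub>G\<^esub> h) x)) = act N a (f (act M (inv\<^bsub>G\<^esub> a) x))" if h: "h \<in> C" for h
  proof -
    obtain p where p: "p \<in> P" "h = a \<otimes>\<^bsub>G\<^esub> p" using h a(2) by (auto simp: l_coset_def)
    have pc: "p \<in> carrier G" using p(1) by simp
    have fx: "f (act M (inv\<^bsub>G\<^esub> a) x) \<in> carrier N" using Hom_over_closed[OF f] a x by simp
    have "f (act M (inv\<^bsub>G\<^esub> h) x) = f (act M (inv\<^bsub>G\<^esub> p) (act M (inv\<^bsub>G\<^esub> a) x))"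
      using a(1) pc x by (simp add: p(2) G.inv_mult_group M.act_mult)
    also have "\<dots> = act N (inv\<^bsub>G\<^esub> p) (f (act M (inv\<^bsub>G\<^esub> a) x))"
      using p(1) a(1) x by (intro Hom_over_act[OF f]) auto
    finally have "act N h (f (act M (inv\<^bsub>G\<^esub> h) x))
        = act N a (act N p (act N (inv\<^bsub>G\<^esub> p) (f (act M (inv\<^bsub>G\<^esub> a) x))))"
      using a(1) pc fx by (simp add: p(2) N.act_mult)
    also have "act N p (act N (inv\<^bsub>G\<^esub> p) (f (act M (inv\<^bsub>G\<^esub> a) x))) = f (act M (inv\<^bsub>G\<^esub> a) x)"
      using pc fx by (simp add: N.act_mult[symmetric])
    finally show ?thesis .
  qed
  show ?thesis unfolding conjugate_def Let_def using indep[OF s] indep[OF C(2)] by simp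
qed

lemma conjugate_closed:
  assumes P: "subgroup P G" and f: "f \<in> Hom_over k P M N"
    and C: "C \<in> lcosets\<^bsub>G\<^esub> P" and x: "x \<in> carrier M"
  shows "conjugate G M N f C x \<in> carrier N"
    and "\<exists>g\<in>carrier G. g \<in> C"
proof -
  interpret G: group G by (rule M.is_group)
  obtain g where g: "g \<in> carrier G" "C = g <#\<^bsub>G\<^esub> P" using C by (auto simp: LCOSETS_def)
  then have "g \<in> C" using G.lcos_self[OF g(1) P] by simp
  then show "\<exists>g\<in>carrier G. g \<in> C" using g by blast
  from conjugate_eq[OF P f C \<open>g \<in> C\<close> x]
  show "conjugate G M N f C x \<in> carrier N" using g(1) x Hom_over_closed[OF f] by simp
qed

lemma finite_lcosets: "finite (carrier G) \<Longrightarrow> subgroup P G \<Longrightarrow> finite (lcosets\<^bsub>G\<^esub> P)"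
  using group.lcosets_subset_PowG[OF M.is_group] by (meson finite_Pow_iff finite_subset)

text \<open>
  The summands are linear, and \<open>h\<close> carries the summand of the coset \<open>C\<close> at \<open>x\<close> to the summand
  of \<open>h C\<close> at \<open>h x\<close>.
\<close>

lemma transfer_in_Hom_over:
  assumes G: "finite (carrier G)" and P: "subgroup P G" and f: "f \<in> Hom_over k P M N"
  shows "transfer G P M N f \<in> Hom_over k (carrier G) M N"
  unfolding transfer_conjugate
proof (rule Hom_overI)
  interpret G: group G by (rule M.is_group)
  interpret f: linear_map k M N f by (rule Hom_over_linear_map[OF f])
  note fin = finite_lcosets[OF G P] and cl = conjugate_closed[OF P f]
  have Pi: "(\<lambda>C. conjugate G M N f C x) \<in> lcosets\<^bsub>G\<^esub> P \<rightarrow> carrier N" if "x \<in> carrier M" for x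
    using cl(1) that by auto
  have add: "conjugate G M N f C (x \<oplus>\<^bsub>M\<^esub> y) = conjugate G M N f C x \<oplus>\<^bsub>N\<^esub> conjugate G M N f C y"
    if C: "C \<in> lcosets\<^bsub>G\<^esub> P" and xy: "x \<in> carrier M" "y \<in> carrier M" for C x y
  proof -
    obtain g where g: "g \<in> carrier G" "g \<in> C" using cl(2)[OF C xy(1)] by blast
    show ?thesis using g(1) xy
      by (simp add: conjugate_eq[OF P f C g(2)] M.act_add N.act_add f.map_add)
  qed
  have smult: "conjugate G M N f C (a \<odot>\<^bsub>M\<^esub> x) = a \<odot>\<^bsub>N\<^esub> conjugate G M N f C x"
    if C: "C \<in> lcosets\<^bsub>G\<^esub> P" and ax: "a \<in> carrier k" "x \<in> carrier M" for C a x
  proof -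
    obtain g where g: "g \<in> carrier G" "g \<in> C" using cl(2)[OF C ax(2)] by blast
    show ?thesis using g(1) ax
      by (simp add: conjugate_eq[OF P f C g(2)] M.act_smult N.act_smult f.map_smult)
  qed
  show "linear_map k M N (\<lambda>x. \<Oplus>\<^bsub>N\<^esub>C\<in>lcosets\<^bsub>G\<^esub> P. conjugate G M N f C x)"
  proof unfold_locales
    fix x assume x: "x \<in> carrier M"
    show "(\<Oplus>\<^bsub>N\<^esub>C\<in>lcosets\<^bsub>G\<^esub> P. conjugate G M N f C x) \<in> carrier N" using Pi[OF x] by simp
    fix y assume y: "y \<in> carrier M"
    have "(\<Oplus>\<^bsub>N\<^esub>C\<in>lcosets\<^bsub>G\<^esub> P. conjugate G M N f C (x \<oplus>\<^bsub>M\<^esub> y)) =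
      (\<Oplus>\<^bsub>N\<^esub>C\<in>lcosets\<^bsub>G\<^esub> P. conjugate G M N f C x \<oplus>\<^bsub>N\<^esub> conjugate G M N f C y)"
      using Pi x y by (intro N.M.finsum_cong' refl add) auto
    then show "(\<Oplus>\<^bsub>N\<^esub>C\<in>lcosets\<^bsub>G\<^esub> P. conjugate G M N f C (x \<oplus>\<^bsub>M\<^esub> y)) =
      (\<Oplus>\<^bsub>N\<^esub>C\<in>lcosets\<^bsub>G\<^esub> P. conjugate G M N f C x) \<oplus>\<^bsub>N\<^esub> (\<Oplus>\<^bsub>N\<^esub>C\<in>lcosets\<^bsub>G\<^esub> P. conjugate G M N f C y)"
      using N.M.finsum_addf[OF Pi[OF x] Pi[OF y]] by simp
  next
    fix a x assume a: "a \<in> carrier k" and x: "x \<in> carrier M"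
    have "(\<Oplus>\<^bsub>N\<^esub>C\<in>lcosets\<^bsub>G\<^esub> P. conjugate G M N f C (a \<odot>\<^bsub>M\<^esub> x)) =
      (\<Oplus>\<^bsub>N\<^esub>C\<in>lcosets\<^bsub>G\<^esub> P. a \<odot>\<^bsub>N\<^esub> conjugate G M N f C x)"
      using Pi x a by (intro N.M.finsum_cong' refl smult) auto
    then show "(\<Oplus>\<^bsub>N\<^esub>C\<in>lcosets\<^bsub>G\<^esub> P. conjugate G M N f C (a \<odot>\<^bsub>M\<^esub> x)) =
      a \<odot>\<^bsub>N\<^esub> (\<Oplus>\<^bsub>N\<^esub>C\<in>lcosets\<^bsub>G\<^esub> P. conjugate G M N f C x)"
      using N.finsum_smult_ldistr[OF fin a Pi[OF x]] by simp
  qed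
  fix h x assume h: "h \<in> carrier G" and x: "x \<in> carrier M"
  have hx: "act M h x \<in> carrier M" using h x by simp
  have shift: "conjugate G M N f (h <#\<^bsub>G\<^esub> C) (act M h x) = act N h (conjugate G M N f C x)"
    if C: "C \<in> lcosets\<^bsub>G\<^esub> P" for C
  proof -
    obtain g where g: "g \<in> carrier G" "g \<in> C" using cl(2)[OF C x] by blast
    have hC: "h <#\<^bsub>G\<^esub> C \<in> lcosets\<^bsub>G\<^esub> P" using G.l_coset_translation(2)[OF P h] C by blast
    have hg: "h \<otimes>\<^bsub>G\<^esub> g \<in> h <#\<^bsub>G\<^esub> C" using g(2) by (auto simp: l_coset_def)
    have "inv\<^bsub>G\<^esub> (h \<otimes>\<^bsub>G\<^esub> g) \<otimes>\<^bsub>G\<^esub> h = inv\<^bsub>G\<^esub> g"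
      using g(1) h by (simp add: G.inv_mult_group G.m_assoc)
    then have "act M (inv\<^bsub>G\<^esub> (h \<otimes>\<^bsub>G\<^esub> g)) (act M h x) = act M (inv\<^bsub>G\<^esub> g) x"
      using g(1) h x by (simp add: M.act_mult[symmetric])
    then show ?thesis
      using g(1) h x Hom_over_closed[OF f]
      by (simp add: conjugate_eq[OF P f hC hg hx] conjugate_eq[OF P f C g(2) x] N.act_mult)
  qed
  have "(\<Oplus>\<^bsub>N\<^esub>C\<in>lcosets\<^bsub>G\<^esub> P. conjugate G M N f C (act M h x))
      = (\<Oplus>\<^bsub>N\<^esub>C\<in>(\<lambda>C. h <#\<^bsub>G\<^esub> C) ` (lcosets\<^bsub>G\<^esub> P). conjugate G M N f C (act M h x))"
    by (simp add: G.l_coset_translation(2)[OF P h])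
  also have "\<dots> = (\<Oplus>\<^bsub>N\<^esub>C\<in>lcosets\<^bsub>G\<^esub> P. conjugate G M N f (h <#\<^bsub>G\<^esub> C) (act M h x))"
    using Pi[OF hx] by (intro N.M.finsum_reindex G.l_coset_translation[OF P h])
      (simp add: G.l_coset_translation(2)[OF P h])
  also have "\<dots> = (\<Oplus>\<^bsub>N\<^esub>C\<in>lcosets\<^bsub>G\<^esub> P. act N h (conjugate G M N f C x))"
    using Pi[OF x] h by (intro N.M.finsum_cong' refl shift) auto
  also have "\<dots> = act N h (\<Oplus>\<^bsub>N\<^esub>C\<in>lcosets\<^bsub>G\<^esub> P. conjugate G M N f C x)"
    by (rule linear_map.map_finsum[OF N.act_linear_map[OF h] fin Pi[OF x], symmetric])
  finally show "(\<Oplus>\<^bsub>N\<^esub>C\<in>lcosets\<^bsub>G\<^esub> P. conjugate G M N f C (act M h x))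
      = act N h (\<Oplus>\<^bsub>N\<^esub>C\<in>lcosets\<^bsub>G\<^esub> P. conjugate G M N f C x)" .
qed simp

lemma transfer_add:
  assumes P: "subgroup P G"
    and f: "f \<in> Hom_over k P M N" and f': "f' \<in> Hom_over k P M N"
  shows "transfer G P M N (\<lambda>x\<in>carrier M. f x \<oplus>\<^bsub>N\<^esub> f' x) =
    (\<lambda>x\<in>carrier M. transfer G P M N f x \<oplus>\<^bsub>N\<^esub> transfer G P M N f' x)"
proof
  interpret G: group G by (rule M.is_group)
  let ?s = "\<lambda>x\<in>carrier M. f x \<oplus>\<^bsub>N\<^esub> f' x"
  have s: "?s \<in> Hom_over k P M N" by (rule Hom_over_add[OF subgroup.subset[OF P] f f'])
  fix x
  show "transfer G P M N ?s x = (\<lambda>x\<in>carrier M. transfer G P M N f x \<oplus>\<^bsub>N\<^esub> transfer G P M N f' x) x"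
  proof (cases "x \<in> carrier M")
    case x: True
    have "conjugate G M N ?s C x = conjugate G M N f C x \<oplus>\<^bsub>N\<^esub> conjugate G M N f' C x"
      if C: "C \<in> lcosets\<^bsub>G\<^esub> P" for C
    proof -
      obtain g where g: "g \<in> carrier G" "g \<in> C" using conjugate_closed(2)[OF P f C x] by blast
      show ?thesis using g(1) x
        by (simp add: conjugate_eq[OF P s C g(2)] conjugate_eq[OF P f C g(2)] conjugate_eq[OF P f' C g(2)]
            N.act_add Hom_over_closed[OF f] Hom_over_closed[OF f'])
    qed
    then have "(\<Oplus>\<^bsub>N\<^esub>C\<in>lcosets\<^bsub>G\<^esub> P. conjugate G M N ?s C x) =
      (\<Oplus>\<^bsub>N\<^esub>C\<in>lcosets\<^bsub>G\<^esub> P. conjugate G M N f C x \<oplus>\<^bsub>N\<^esub> conjugate G M N f' C x)"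
      using x conjugate_closed(1)[OF P] f f' by (intro N.M.finsum_cong') auto
    also have "\<dots> = (\<Oplus>\<^bsub>N\<^esub>C\<in>lcosets\<^bsub>G\<^esub> P. conjugate G M N f C x) \<oplus>\<^bsub>N\<^esub> (\<Oplus>\<^bsub>N\<^esub>C\<in>lcosets\<^bsub>G\<^esub> P. conjugate G M N f' C x)"
      using x conjugate_closed(1)[OF P] f f' by (intro N.M.finsum_addf) auto
    finally show ?thesis using x by (simp add: transfer_conjugate)
  qed (simp add: transfer_def)
qed

text \<open>
  Transfer is natural in the target. Applied to multiplication by an element of \<open>R\<close>, this makes the
  images of transfer \<open>R\<close>-submodules.
\<close>

lemma transfer_compose:
  assumes G: "finite (carrier G)" and P: "subgroup P G"
    and f: "f \<in> Hom_over k P M N" and \<rho>: "\<rho> \<in> Hom_over k (carrier G) N N"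
  shows "transfer G P M N (compose (carrier M) \<rho> f) = compose (carrier M) \<rho> (transfer G P M N f)"
proof
  interpret G: group G by (rule M.is_group)
  interpret NN: group_module_pair k G N N by unfold_locales
  interpret \<rho>: linear_map k N N \<rho> by (rule NN.Hom_over_linear_map[OF \<rho>])
  let ?s = "compose (carrier M) \<rho> f"
  have Pc: "P \<subseteq> carrier G" by (rule subgroup.subset[OF P])
  have s: "?s \<in> Hom_over k P M N"
    by (rule Hom_over_compose[OF group_module_pair_axioms NN.group_module_pair_axioms Pc Pc f \<rho>])
  fix x
  show "transfer G P M N ?s x = compose (carrier M) \<rho> (transfer G P M N f) x"
  proof (cases "x \<in> carrier M")
    case x: True
    have "conjugate G M N ?s C x = \<rho> (conjugate G M N f C x)"
      if C: "C \<in> lcosets\<^bsub>G\<^esub> P" for C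
    proof -
      obtain g where g: "g \<in> carrier G" "g \<in> C" using conjugate_closed(2)[OF P f C x] by blast
      show ?thesis
        unfolding conjugate_eq[OF P s C g(2) x] conjugate_eq[OF P f C g(2) x]
        using g(1) x by (simp add: compose_def NN.Hom_over_act[OF \<rho>] Hom_over_closed[OF f])
    qed
    then have "(\<Oplus>\<^bsub>N\<^esub>C\<in>lcosets\<^bsub>G\<^esub> P. conjugate G M N ?s C x) =
      (\<Oplus>\<^bsub>N\<^esub>C\<in>lcosets\<^bsub>G\<^esub> P. \<rho> (conjugate G M N f C x))"
      using x conjugate_closed(1)[OF P f] by (intro N.M.finsum_cong') auto
    also have "\<dots> = \<rho> (\<Oplus>\<^bsub>N\<^esub>C\<in>lcosets\<^bsub>G\<^esub> P. conjugate G M N f C x)"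
      using x conjugate_closed(1)[OF P f] by (intro \<rho>.map_finsum[symmetric] finite_lcosets[OF G P]) auto
    finally show ?thesis using x by (simp add: transfer_conjugate compose_def)
  qed (simp add: transfer_def compose_def)
qed

lemma transfer_zero:
  assumes P: "subgroup P G"
  shows "transfer G P M N (\<lambda>x\<in>carrier M. \<zero>\<^bsub>N\<^esub>) = (\<lambda>x\<in>carrier M. \<zero>\<^bsub>N\<^esub>)"
proof -
  let ?z = "\<lambda>x\<in>carrier M. \<zero>\<^bsub>N\<^esub>"
  have z: "?z \<in> Hom_over k P M N" by (rule Hom_over_zero[OF subgroup.subset[OF P]])
  have "(\<Oplus>\<^bsub>N\<^esub>C\<in>lcosets\<^bsub>G\<^esub> P. conjugate G M N ?z C x) = (\<Oplus>\<^bsub>N\<^esub>C\<in>lcosets\<^bsub>G\<^esub> P. \<zero>\<^bsub>N\<^esub>)"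
    if x: "x \<in> carrier M" for x
  proof (rule N.M.finsum_cong')
    interpret G: group G by (rule M.is_group)
    fix C assume C: "C \<in> lcosets\<^bsub>G\<^esub> P"
    then obtain g where g: "g \<in> carrier G" "g \<in> C" using conjugate_closed(2)[OF P z C x] by blast
    show "conjugate G M N ?z C x = \<zero>\<^bsub>N\<^esub>"
      using g(1) x linear_map.map_zero[OF N.act_linear_map[OF g(1)]]
      by (simp add: conjugate_eq[OF P z C g(2)])
  qed auto
  then show ?thesis unfolding transfer_conjugate by (intro restrict_ext) simp
qed

end

section \<open>The space of homomorphisms as a module over the algebra\<close>

text \<open>
  Every \<open>r\<close> in \<open>R\<close> acts on \<open>S\<close> by a \<open>kG\<close>-endomorphism, because \<open>R\<close> is commutative and \<open>G\<close> acts
  \<open>R\<close>-linearly. The \<open>R\<close>-action on homomorphisms into \<open>S\<close> is composition with these endomorphisms,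
  which is how everything natural in the target becomes \<open>R\<close>-linear below.
\<close>

locale hom_space = algebra k R + S: group_module R G S + M: group_module k G M
  for k :: "('k, 'c) ring_scheme" and R :: "('k, 'r) module" and G :: "('g, 'd) monoid_scheme"
    and S :: "('r, 's, 'g) gmodule" and M :: "('k, 'm, 'g) gmodule"
begin

abbreviation "N \<equiv> restrict_scalars R S"

sublocale N: group_module k G N
  by (rule restrict_scalars_group_module[OF algebra_axioms S.group_module_axioms])

sublocale MN: group_module_pair k G M N by unfold_locales

abbreviation "H \<equiv> Hom_module k R G M S"

definition "scaling r = (\<lambda>s\<in>carrier S. r \<odot>\<^bsub>S\<^esub> s)"

lemma scaling_Hom:
  assumes r: "r \<in> carrier R"
  shows "scaling r \<in> Hom_over k (carrier G) N N"
proof -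
  interpret NN: group_module_pair k G N N by unfold_locales
  have comm: "r \<odot>\<^bsub>S\<^esub> ((a \<odot>\<^bsub>R\<^esub> \<one>\<^bsub>R\<^esub>) \<odot>\<^bsub>S\<^esub> x) = (a \<odot>\<^bsub>R\<^esub> \<one>\<^bsub>R\<^esub>) \<odot>\<^bsub>S\<^esub> (r \<odot>\<^bsub>S\<^esub> x)"
    if "a \<in> carrier k" "x \<in> carrier S" for a x
    using that r by (simp add: S.smult_assoc1[symmetric] m_comm)
  have "linear_map k N N (\<lambda>s. r \<odot>\<^bsub>S\<^esub> s)"
    by unfold_locales (use r comm in \<open>auto simp: S.smult_r_distr\<close>)
  from NN.Hom_overI[OF this, of "carrier G"] show ?thesis
    using r by (simp add: scaling_def S.act_smult)
qed

lemma Hom_module_simps: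
  "carrier H = Hom_over k (carrier G) M N"
  "\<zero>\<^bsub>H\<^esub> = (\<lambda>x\<in>carrier M. \<zero>\<^bsub>S\<^esub>)"
  "f \<oplus>\<^bsub>H\<^esub> g = (\<lambda>x\<in>carrier M. f x \<oplus>\<^bsub>S\<^esub> g x)"
  "r \<odot>\<^bsub>H\<^esub> f = (\<lambda>x\<in>carrier M. r \<odot>\<^bsub>S\<^esub> f x)"
  by (simp_all add: Hom_module_def)

lemma smult_eq_compose_scaling:
  assumes "f \<in> Hom_over k P M N"
  shows "(\<lambda>x\<in>carrier M. r \<odot>\<^bsub>S\<^esub> f x) = compose (carrier M) (scaling r) f"
  unfolding compose_def scaling_def
  using MN.Hom_over_closed[OF assms] by (intro restrict_ext) simp

lemma Hom_over_smult:
  assumes "P \<subseteq> carrier G" "r \<in> carrier R" "f \<in> Hom_over k P M N"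
  shows "(\<lambda>x\<in>carrier M. r \<odot>\<^bsub>S\<^esub> f x) \<in> Hom_over k P M N"
proof -
  interpret NN: group_module_pair k G N N by unfold_locales
  show ?thesis unfolding smult_eq_compose_scaling[OF assms(3)]
    by (rule Hom_over_compose[OF MN.group_module_pair_axioms NN.group_module_pair_axioms
          assms(1) assms(1) assms(3) scaling_Hom[OF assms(2)]])
qed

sublocale H: module R H
proof (rule moduleI)
  have cl: "f x \<in> carrier S" if "f \<in> carrier H" "x \<in> carrier M" for f x
    using MN.Hom_over_closed that by (simp add: Hom_module_simps)
  have ext: "(\<lambda>x\<in>carrier M. f x) = f" if "f \<in> carrier H" for f
    using MN.Hom_over_extensional that by (simp add: Hom_module_simps extensional_restrict)
  have add: "f \<oplus>\<^bsub>H\<^esub> g \<in> carrier H" if "f \<in> carrier H" "g \<in> carrier H" for f g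
    using MN.Hom_over_add[OF subset_refl] that by (simp add: Hom_module_simps)
  have zero: "\<zero>\<^bsub>H\<^esub> \<in> carrier H"
    using MN.Hom_over_zero[OF subset_refl] by (simp add: Hom_module_simps)
  show smult: "r \<odot>\<^bsub>H\<^esub> f \<in> carrier H" if "r \<in> carrier R" "f \<in> carrier H" for r f
    using Hom_over_smult[OF subset_refl] that by (simp add: Hom_module_simps)
  show "cring R" by (rule M_cring)
  show "abelian_group H"
  proof (rule abelian_groupI)
    fix f assume f: "f \<in> carrier H"
    show "\<zero>\<^bsub>H\<^esub> \<oplus>\<^bsub>H\<^esub> f = f"
      using cl[OF f] by (subst (2) ext[OF f, symmetric]) (auto simp: Hom_module_simps intro!: restrict_ext)
    \<comment> \<open>The additive inverse is taken to be the multiple by \<open>-1\<close>, already known to be in the carrier.\<close>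
    have "((\<ominus>\<^bsub>R\<^esub> \<one>\<^bsub>R\<^esub>) \<odot>\<^bsub>H\<^esub> f) \<oplus>\<^bsub>H\<^esub> f = \<zero>\<^bsub>H\<^esub>"
      unfolding Hom_module_simps
      by (rule restrict_ext) (simp add: cl[OF f] S.smult_l_minus S.M.l_neg)
    then show "\<exists>g\<in>carrier H. g \<oplus>\<^bsub>H\<^esub> f = \<zero>\<^bsub>H\<^esub>"
      using smult[OF _ f, of "\<ominus>\<^bsub>R\<^esub> \<one>\<^bsub>R\<^esub>"] by auto
    fix g assume g: "g \<in> carrier H"
    show "f \<oplus>\<^bsub>H\<^esub> g = g \<oplus>\<^bsub>H\<^esub> f"
      unfolding Hom_module_simps by (rule restrict_ext) (simp add: cl[OF f] cl[OF g] S.M.a_comm)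
    fix h assume h: "h \<in> carrier H"
    show "f \<oplus>\<^bsub>H\<^esub> g \<oplus>\<^bsub>H\<^esub> h = f \<oplus>\<^bsub>H\<^esub> (g \<oplus>\<^bsub>H\<^esub> h)"
      unfolding Hom_module_simps
      by (rule restrict_ext) (simp add: cl[OF f] cl[OF g] cl[OF h] S.M.a_assoc)
  qed (use add zero in auto)
  fix f assume f: "f \<in> carrier H"
  show "\<one>\<^bsub>R\<^esub> \<odot>\<^bsub>H\<^esub> f = f"
    using cl[OF f] by (subst (2) ext[OF f, symmetric]) (auto simp: Hom_module_simps intro!: restrict_ext)
  fix a assume a: "a \<in> carrier R"
  show "a \<odot>\<^bsub>H\<^esub> (f \<oplus>\<^bsub>H\<^esub> g) = a \<odot>\<^bsub>H\<^esub> f \<oplus>\<^bsub>H\<^esub> a \<odot>\<^bsub>H\<^esub> g" if g: "g \<in> carrier H" for g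
    unfolding Hom_module_simps
    by (rule restrict_ext) (simp add: cl[OF f] cl[OF g] a S.smult_r_distr)
  fix b assume b: "b \<in> carrier R"
  show "(a \<oplus>\<^bsub>R\<^esub> b) \<odot>\<^bsub>H\<^esub> f = a \<odot>\<^bsub>H\<^esub> f \<oplus>\<^bsub>H\<^esub> b \<odot>\<^bsub>H\<^esub> f"
    unfolding Hom_module_simps
    by (rule restrict_ext) (simp add: cl[OF f] a b S.smult_l_distr)
  show "(a \<otimes>\<^bsub>R\<^esub> b) \<odot>\<^bsub>H\<^esub> f = a \<odot>\<^bsub>H\<^esub> (b \<odot>\<^bsub>H\<^esub> f)"
    unfolding Hom_module_simps
    by (rule restrict_ext) (simp add: cl[OF f] a b S.smult_assoc1)
qed

lemma evaluation_linear_map: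
  assumes "x \<in> carrier M"
  shows "linear_map R H S (\<lambda>f. f x)"
  by unfold_locales (use assms MN.Hom_over_closed in \<open>auto simp: Hom_module_simps\<close>)

lemma submodule_vanishing:
  assumes C: "C \<subseteq> carrier M"
  shows "submodule {f \<in> carrier H. \<forall>x\<in>C. f x = \<zero>\<^bsub>S\<^esub>} R H"
proof (rule H.submoduleI_no_minus)
  have Cm: "x \<in> carrier M" if "x \<in> C" for x using that C by blast
  show "\<zero>\<^bsub>H\<^esub> \<in> {f \<in> carrier H. \<forall>x\<in>C. f x = \<zero>\<^bsub>S\<^esub>}"
    using H.zero_closed by (simp add: Hom_module_simps(2) Cm)
  fix f assume f: "f \<in> {f \<in> carrier H. \<forall>x\<in>C. f x = \<zero>\<^bsub>S\<^esub>}"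
  show "f \<oplus>\<^bsub>H\<^esub> g \<in> {f \<in> carrier H. \<forall>x\<in>C. f x = \<zero>\<^bsub>S\<^esub>}"
    if "g \<in> {f \<in> carrier H. \<forall>x\<in>C. f x = \<zero>\<^bsub>S\<^esub>}" for g
    using that f H.M.add.m_closed[of f g] by (simp add: Hom_module_simps(3) Cm)
  show "r \<odot>\<^bsub>H\<^esub> f \<in> {f \<in> carrier H. \<forall>x\<in>C. f x = \<zero>\<^bsub>S\<^esub>}" if "r \<in> carrier R" for r
    using that f H.smult_closed[of r f] by (simp add: Hom_module_simps(4) Cm)
qed blast

text \<open>
  The vanishing conditions at the elements of \<open>B\<close> are removed one at a time: the homomorphisms that
  vanish at one more point \<open>b\<close> are the kernel of evaluation at \<open>b\<close>, which takes values in the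
  Noetherian module \<open>S\<close>.
\<close>

lemma noetherian_if_vanishing_noetherian:
  assumes S: "S.noetherian_submodule (carrier S)" and B: "finite B"
  shows "B \<union> C \<subseteq> carrier M \<Longrightarrow>
    H.noetherian_submodule {f \<in> carrier H. \<forall>x\<in>B \<union> C. f x = \<zero>\<^bsub>S\<^esub>} \<Longrightarrow>
    H.noetherian_submodule {f \<in> carrier H. \<forall>x\<in>C. f x = \<zero>\<^bsub>S\<^esub>}"
  using B
proof (induction B arbitrary: C)
  case empty then show ?case by simp
next
  case (insert b B)
  interpret ev: linear_map R H S "\<lambda>f. f b"
    using insert.prems by (intro evaluation_linear_map) auto
  have BC: "insert b B \<union> C = B \<union> insert b C" by blast
  have "H.noetherian_submodule {f \<in> carrier H. \<forall>x\<in>insert b C. f x = \<zero>\<^bsub>S\<^esub>}"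
    using insert.prems unfolding BC by (rule insert.IH)
  moreover have "{f \<in> {f \<in> carrier H. \<forall>x\<in>C. f x = \<zero>\<^bsub>S\<^esub>}. f b = \<zero>\<^bsub>S\<^esub>}
      = {f \<in> carrier H. \<forall>x\<in>insert b C. f x = \<zero>\<^bsub>S\<^esub>}" by auto
  ultimately have ker: "H.noetherian_submodule {f \<in> {f \<in> carrier H. \<forall>x\<in>C. f x = \<zero>\<^bsub>S\<^esub>}. f b = \<zero>\<^bsub>S\<^esub>}"
    by (simp only:)
  have "C \<subseteq> carrier M" using insert.prems(1) by simp
  from ev.noetherian_submodule_if_kernel_and_codomain[OF submodule_vanishing[OF this] S ker]
  show ?case .
qed

text \<open>
  A homomorphism that vanishes on a finite generating set of \<open>M\<close> is zero, so evaluation on the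
  generators filters \<open>Hom\<close> by finitely many submodules whose successive quotients embed in \<open>S\<close>.
\<close>

lemma Hom_module_noetherian:
  assumes S: "S.noetherian_submodule (carrier S)" and M: "M.fg_submodule (carrier M)"
  shows "H.noetherian_submodule (carrier H)"
proof -
  obtain A where A: "A \<subseteq> carrier M" "finite A" "carrier M \<subseteq> M.lin_span A"
    using M unfolding M.fg_submodule_def by (elim exE conjE)
  have "f = \<zero>\<^bsub>H\<^esub>" if f: "f \<in> carrier H" and 0: "\<forall>x\<in>A. f x = \<zero>\<^bsub>S\<^esub>" for f
  proof -
    have fH: "f \<in> Hom_over k (carrier G) M N" using f by (simp add: Hom_module_simps)
    interpret f: linear_map k M N f by (rule MN.Hom_over_linear_map[OF fH])
    have "M.lin_span A \<subseteq> {x \<in> carrier M. f x = \<zero>\<^bsub>N\<^esub>}"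
      using A 0 by (intro M.lin_span_least f.kernel_submodule M.carrier_is_submodule) auto
    then have "f x = \<zero>\<^bsub>S\<^esub>" if "x \<in> carrier M" for x using that A(3) by auto
    then have "restrict f (carrier M) = \<zero>\<^bsub>H\<^esub>"
      unfolding Hom_module_simps by (intro restrict_ext)
    then show ?thesis using MN.Hom_over_extensional[OF fH] by (simp add: extensional_restrict)
  qed
  then have "{f \<in> carrier H. \<forall>x\<in>A \<union> {}. f x = \<zero>\<^bsub>S\<^esub>} \<subseteq> {\<zero>\<^bsub>H\<^esub>}" by auto
  moreover have "H.lin_span {} = {\<zero>\<^bsub>H\<^esub>}" by (simp add: H.lin_span_def)
  ultimately have "H.noetherian_submodule {f \<in> carrier H. \<forall>x\<in>A \<union> {}. f x = \<zero>\<^bsub>S\<^esub>}"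
    unfolding H.noetherian_submodule_def H.fg_submodule_def
    by (intro allI impI exI[of _ "{}"]) auto
  from noetherian_if_vanishing_noetherian[OF S A(2) _ this] A(1)
  show ?thesis by simp
qed

lemma transfer_image_submodule:
  assumes G: "finite (carrier G)" and P: "subgroup P G"
  shows "submodule (transfer G P M N ` Hom_over k P M N) R H"
proof (rule H.submoduleI_no_minus)
  let ?T = "transfer G P M N ` Hom_over k P M N"
  have Pc: "P \<subseteq> carrier G" by (rule subgroup.subset[OF P])
  show "?T \<subseteq> carrier H"
    using MN.transfer_in_Hom_over[OF G P] by (auto simp: Hom_module_simps)
  show "\<zero>\<^bsub>H\<^esub> \<in> ?T"
    using MN.transfer_zero[OF P] MN.Hom_over_zero[OF Pc]
    by (intro image_eqI[of _ _ "\<lambda>x\<in>carrier M. \<zero>\<^bsub>S\<^esub>"]) (simp_all add: Hom_module_simps)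
  fix a b assume "a \<in> ?T" "b \<in> ?T"
  then obtain f g where f: "f \<in> Hom_over k P M N" "a = transfer G P M N f"
    and g: "g \<in> Hom_over k P M N" "b = transfer G P M N g" by blast
  show "a \<oplus>\<^bsub>H\<^esub> b \<in> ?T"
    using MN.transfer_add[OF P f(1) g(1)] MN.Hom_over_add[OF Pc f(1) g(1)]
    by (intro image_eqI[of _ _ "\<lambda>x\<in>carrier M. f x \<oplus>\<^bsub>S\<^esub> g x"]) (simp_all add: Hom_module_simps f(2) g(2))
next
  let ?T = "transfer G P M N ` Hom_over k P M N"
  have Pc: "P \<subseteq> carrier G" by (rule subgroup.subset[OF P])
  fix r a assume r: "r \<in> carrier R" and "a \<in> ?T"
  then obtain f where f: "f \<in> Hom_over k P M N" "a = transfer G P M N f" by blast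
  have "r \<odot>\<^bsub>H\<^esub> a = transfer G P M N (compose (carrier M) (scaling r) f)"
    unfolding MN.transfer_compose[OF G P f(1) scaling_Hom[OF r]] Hom_module_simps f(2)
    by (rule smult_eq_compose_scaling[OF MN.transfer_in_Hom_over[OF G P f(1)]])
  then show "r \<odot>\<^bsub>H\<^esub> a \<in> ?T"
    using Hom_over_smult[OF Pc r f(1)] unfolding smult_eq_compose_scaling[OF f(1)] by blast
qed

lemma finsum_Hom_module:
  assumes "finite X" "t \<in> X \<rightarrow> carrier H"
  shows "(\<Oplus>\<^bsub>H\<^esub>P\<in>X. t P) = (\<lambda>x\<in>carrier M. \<Oplus>\<^bsub>S\<^esub>P\<in>X. t P x)"
proof -
  have "(\<Oplus>\<^bsub>H\<^esub>P\<in>X. t P) x = (\<Oplus>\<^bsub>S\<^esub>P\<in>X. t P x)" if "x \<in> carrier M" for x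
    using linear_map.map_finsum[OF evaluation_linear_map[OF that] assms] .
  moreover have "(\<Oplus>\<^bsub>H\<^esub>P\<in>X. t P) \<in> Hom_over k (carrier G) M N"
    using H.M.finsum_closed[OF assms(2)] by (simp add: Hom_module_simps)
  ultimately show ?thesis
    using MN.Hom_over_extensional by (intro extensionalityI[of _ "carrier M"]) auto
qed

text \<open>
  The finite group \<open>G\<close> has finitely many subgroups, so the sum over \<open>\<X>\<close> is finite.
\<close>

lemma transfer_sum_submodule:
  assumes G: "finite (carrier G)" and X: "\<And>P. P \<in> \<X> \<Longrightarrow> subgroup P G"
  shows "submodule (transfer_sum k G \<X> M N) R H"
proof -
  have fin: "finite \<X>"
    using X subgroup.subset by (intro finite_subset[of \<X> "Pow (carrier G)"]) (use G in auto)
  let ?T = "\<lambda>P. transfer G P M N ` Hom_over k P M N"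
  note T = transfer_image_submodule[OF G X]
  have "(\<lambda>x\<in>carrier M. \<Oplus>\<^bsub>S\<^esub>P\<in>\<X>. t P x) = (\<Oplus>\<^bsub>H\<^esub>P\<in>\<X>. t P)" if "t \<in> (\<Pi> P\<in>\<X>. ?T P)" for t
    using that H.submoduleE(1)[OF T] by (intro finsum_Hom_module[OF fin, symmetric]) blast
  then have "transfer_sum k G \<X> M N = {\<Oplus>\<^bsub>H\<^esub>P\<in>\<X>. t P | t. t \<in> (\<Pi> P\<in>\<X>. ?T P)}"
    unfolding transfer_sum_def finsum_restrict_scalars by (intro Collect_cong ex_cong1) auto
  then show ?thesis using H.submodule_finsum[OF fin T] by simp
qed

lemma Hom_module_fg:
  assumes "noetherian_ring R" "finite_module R S" "finite_module k M"
  shows "H.fg_submodule (carrier H)"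
proof -
  have "H.noetherian_submodule (carrier H)"
    using Hom_module_noetherian finite_module.noetherian_carrier[OF assms(2,1)] assms(3)
    by (simp add: M.finite_module_iff_fg_submodule)
  then show ?thesis
    using H.carrier_is_submodule by (rule H.noetherian_imp_fg_submodule) simp
qed

theorem Hom_rel_finite:
  assumes "noetherian_ring R" "finite_module R S" "finite_module k M"
    and "finite (carrier G)" "\<And>P. P \<in> \<X> \<Longrightarrow> subgroup P G"
  shows "finite_module R (Hom_rel k R G \<X> M S)"
  unfolding Hom_rel_def
  by (rule H.finite_quotient_module[OF Hom_module_fg[OF assms(1-3)] transfer_sum_submodule[OF assms(4,5)]])

end

section \<open>Fitting's lemma\<close>

lemma (in field) noetherian_ring: "noetherian_ring R"
proof (rule noetherian_ringI)
  fix I assume "ideal I R"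
  then have "I = {\<zero>} \<or> I = carrier R" using all_ideals by blast
  then have "I = Idl {\<zero>} \<or> I = Idl {\<one>}" by (simp add: genideal_zero genideal_one)
  then show "\<exists>A\<subseteq>carrier R. finite A \<and> I = Idl A"
    by (metis empty_subsetI finite.emptyI finite_insert insert_subset one_closed zero_closed)
qed

lemma (in module) noetherian_chain_stabilizes:
  assumes noeth: "noetherian_submodule (carrier M)"
    and W: "\<And>n::nat. submodule (W n) R M" and step: "\<And>n. W n \<subseteq> W (Suc n)"
  shows "\<exists>n. \<forall>m\<ge>n. W m = W n"
proof -
  have mono: "W i \<subseteq> W j" if "i \<le> j" for i j using lift_Suc_mono_le[of W] step that by blast
  let ?U = "\<Union>n. W n"
  have "submodule ?U R M"
  proof (rule submoduleI_no_minus)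
    show "?U \<subseteq> carrier M" using submoduleE(1)[OF W] by blast
    show "\<zero>\<^bsub>M\<^esub> \<in> ?U" using submodule_zero_closed[OF W] by blast
    show "a \<odot>\<^bsub>M\<^esub> x \<in> ?U" if "a \<in> carrier R" "x \<in> ?U" for a x
      using that submoduleE(4)[OF W] by blast
    fix x y assume "x \<in> ?U" "y \<in> ?U"
    then obtain i j where ij: "x \<in> W i" "y \<in> W j" by blast
    then have "x \<in> W (max i j)" "y \<in> W (max i j)"
      using mono[of i "max i j"] mono[of j "max i j"] by auto
    then show "x \<oplus>\<^bsub>M\<^esub> y \<in> ?U" using submoduleE(5)[OF W] by blast
  qed
  moreover from this have "?U \<subseteq> carrier M" by (rule submoduleE(1))
  ultimately have "fg_submodule ?U" by (rule noetherian_imp_fg_submodule[OF noeth])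
  then obtain A where A: "A \<subseteq> ?U" "finite A" "?U \<subseteq> lin_span A"
    unfolding fg_submodule_def by (elim exE conjE)
  have "\<exists>n. A \<subseteq> W n" using A(2,1)
  proof (induction A)
    case (insert a A)
    then obtain n i where "A \<subseteq> W n" "a \<in> W i" by auto
    then have "insert a A \<subseteq> W (max n i)"
      using mono[of n "max n i"] mono[of i "max n i"] by auto
    then show ?case by blast
  qed simp
  then obtain n where "A \<subseteq> W n" by blast
  then have "?U \<subseteq> W n" using A(3) lin_span_least[OF W A(2)] by blast
  then have "\<forall>m\<ge>n. W m = W n" using mono by blast
  then show ?thesis by blast
qed

lemma (in module) set_add_mono: "\<lbrakk>U \<subseteq> U'; V \<subseteq> V'\<rbrakk> \<Longrightarrow> U <+>\<^bsub>M\<^esub> V \<subseteq> U' <+>\<^bsub>M\<^esub> V'"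
  unfolding set_add_def' by blast

locale endomorphism = linear_map R M M \<phi>
  for R :: "('a, 'c) ring_scheme" and M :: "('a, 'm, 'd) module_scheme" and \<phi>
begin

lemma funpow_linear_map: "linear_map R M M (\<phi> ^^ n)"
proof (induction n)
  case 0 show ?case by unfold_locales auto
next
  case (Suc n)
  interpret p: linear_map R M M "\<phi> ^^ n" by (rule Suc)
  show ?case by unfold_locales (auto simp: p.map_add p.map_smult map_add map_smult)
qed

definition "power_kernel n = {x \<in> carrier M. (\<phi> ^^ n) x = \<zero>\<^bsub>M\<^esub>}"

lemma power_kernel_submodule: "submodule (power_kernel n) R M"
  unfolding power_kernel_def
  by (rule linear_map.kernel_submodule[OF funpow_linear_map H.carrier_is_submodule])

lemma power_kernel_Suc: "power_kernel n \<subseteq> power_kernel (Suc n)"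
  by (auto simp: power_kernel_def)

lemma power_kernel_Suc_iff: "x \<in> carrier M \<Longrightarrow> x \<in> power_kernel (Suc n) \<longleftrightarrow> \<phi> x \<in> power_kernel n"
  by (simp add: power_kernel_def funpow_swap1)

lemma power_kernel_closed: "x \<in> power_kernel n \<Longrightarrow> \<phi> x \<in> power_kernel n"
  using power_kernel_Suc power_kernel_Suc_iff unfolding power_kernel_def by blast

text \<open>
  A substitute for dimension counting (\<open>K\<close> denotes the kernel of \<open>\<phi>\<^sup>n\<close>, which contains the kernel of
  every higher power). If \<open>x\<close> were not in \<open>K + \<phi> M\<close>, the spans \<open>W i\<close> of \<open>K\<close> and
  \<open>x, \<phi> x, \<dots>, \<phi>\<^sup>i\<^sup>-\<^sup>1 x\<close> would grow forever. Indeed a relation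
  \<open>\<phi>\<^sup>i\<^sup>+\<^sup>1 x = a x + \<phi> u + \<kappa>\<close> with \<open>u \<in> W i\<close> and \<open>\<kappa> \<in> K\<close> forces \<open>a = 0\<close>, as otherwise \<open>x\<close> could be
  divided out; then \<open>\<phi>\<^sup>i x - u\<close> lies in \<open>K\<close> and the relation descends to \<open>\<phi>\<^sup>i x \<in> W i\<close>, ending at
  \<open>x \<in> K\<close>.
\<close>

lemma carrier_eq_kernel_plus_image:
  assumes field: "field R" and noeth: "H.noetherian_submodule (carrier M)"
    and stable: "power_kernel (Suc n) = power_kernel n" and x: "x \<in> carrier M"
  shows "x \<in> power_kernel n <+>\<^bsub>M\<^esub> \<phi> ` carrier M"
proof (rule ccontr)
  let ?K = "power_kernel n" and ?V = "power_kernel n <+>\<^bsub>M\<^esub> \<phi> ` carrier M"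
  let ?L = "H.lin_span {x}"
  assume notin: "x \<notin> ?V"
  note K = power_kernel_submodule[of n]
  note Kc = H.submoduleE[OF K] H.submodule_zero_closed[OF K]
  have V: "submodule ?V R M"
    by (intro H.submodule_set_add K image_submodule H.carrier_is_submodule)
  have L: "submodule ?L R M" using x by (intro H.lin_span_submodule) auto
  define W where "W = rec_nat ?K (\<lambda>_ U. ?L <+>\<^bsub>M\<^esub> (\<phi> ` U <+>\<^bsub>M\<^esub> ?K))"
  have W0: "W 0 = ?K" and WSuc: "W (Suc i) = ?L <+>\<^bsub>M\<^esub> (\<phi> ` W i <+>\<^bsub>M\<^esub> ?K)" for i
    by (simp_all add: W_def)
  have W: "submodule (W i) R M" for i
    by (induction i) (auto simp only: W0 WSuc intro!: K L H.submodule_set_add image_submodule)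
  have absorb: "y \<in> U <+>\<^bsub>M\<^esub> U'" if "submodule U R M" "y \<in> U'" "U' \<subseteq> carrier M" for y U U'
    using H.set_add_memI[OF H.submodule_zero_closed[OF that(1)] that(2)] that(2,3) by auto
  have absorb': "y \<in> U <+>\<^bsub>M\<^esub> U'" if "submodule U' R M" "y \<in> U" "U \<subseteq> carrier M" for y U U'
    using H.set_add_memI[OF that(2) H.submodule_zero_closed[OF that(1)]] that(2,3) by auto
  have imW: "submodule (\<phi> ` W i) R M" for i by (rule image_submodule[OF W])
  have PhiK: "submodule (\<phi> ` W i <+>\<^bsub>M\<^esub> ?K) R M" for i by (rule H.submodule_set_add[OF imW K])
  \<comment> \<open>The chain ascends from \<open>K\<close>, and \<open>\<phi>\<^sup>i x\<close> appears in it by stage \<open>i + 1\<close>.\<close>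
  have KW: "?K \<subseteq> W i" for i
  proof (cases i)
    case 0 then show ?thesis by (simp add: W0)
  next
    case (Suc j)
    have "?K \<subseteq> \<phi> ` W j <+>\<^bsub>M\<^esub> ?K" using absorb[OF imW _ Kc(1)] by blast
    then show ?thesis unfolding Suc WSuc using absorb[OF L _ H.submoduleE(1)[OF PhiK]] by blast
  qed
  have step: "W i \<subseteq> W (Suc i)" for i
  proof (induction i)
    case 0 show ?case using KW[of "Suc 0"] unfolding W0 .
  next
    case (Suc i)
    then show ?case unfolding WSuc[of i] WSuc[of "Suc i"]
      by (intro H.set_add_mono image_mono subset_refl)
  qed
  have Lx: "x \<in> ?L" using H.lin_span_superset[of "{x}"] x by auto
  have powc: "(\<phi> ^^ i) x \<in> carrier M" for i
    using linear_map.map_closed[OF funpow_linear_map x] .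
  have orbit: "(\<phi> ^^ i) x \<in> W (Suc i)" for i
  proof (induction i)
    case 0 show ?case
      unfolding WSuc using absorb'[OF PhiK Lx H.submoduleE(1)[OF L]] by simp
  next
    case (Suc i)
    have "(\<phi> ^^ Suc i) x \<in> \<phi> ` W (Suc i)" using Suc by auto
    then have "(\<phi> ^^ Suc i) x \<in> \<phi> ` W (Suc i) <+>\<^bsub>M\<^esub> ?K"
      by (rule absorb'[OF K _ H.submoduleE(1)[OF imW]])
    then show ?case
      unfolding WSuc[of "Suc i"] by (rule absorb[OF L _ H.submoduleE(1)[OF PhiK]])
  qed
  \<comment> \<open>The relation descends along the powers of \<open>\<phi>\<close>, down to the excluded case \<open>x \<in> K\<close>.\<close>
  have descent: "(\<phi> ^^ i) x \<notin> W i" for i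
  proof (induction i)
    case 0
    show ?case using absorb'[OF image_submodule[OF H.carrier_is_submodule] _ Kc(1)] notin
      by (auto simp: W0)
  next
    case (Suc i)
    show ?case
    proof
      assume "(\<phi> ^^ Suc i) x \<in> W (Suc i)"
      then obtain l v where l: "l \<in> ?L" and v: "v \<in> \<phi> ` W i <+>\<^bsub>M\<^esub> ?K"
        and lv: "(\<phi> ^^ Suc i) x = l \<oplus>\<^bsub>M\<^esub> v"
        unfolding WSuc by (rule H.set_add_memE)
      obtain u' \<kappa> where u': "u' \<in> \<phi> ` W i" and \<kappa>: "\<kappa> \<in> ?K" and v': "v = u' \<oplus>\<^bsub>M\<^esub> \<kappa>"
        using v by (rule H.set_add_memE)
      obtain u where u: "u \<in> W i" "u' = \<phi> u" using u' by blast
      obtain a where a: "a \<in> carrier R" "l = a \<odot>\<^bsub>M\<^esub> x"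
      proof -
        have "l \<in> {a \<odot>\<^bsub>M\<^esub> x | a. a \<in> carrier R}" using l x by (auto simp: H.lin_span_def)
        then show ?thesis using that by blast
      qed
      have uc: "u \<in> carrier M" using u(1) H.submoduleE(1)[OF W] by blast
      have \<kappa>c: "\<kappa> \<in> carrier M" using \<kappa> Kc(1) by blast
      let ?d = "(\<phi> ^^ i) x \<ominus>\<^bsub>M\<^esub> u"
      have d: "?d \<in> carrier M" using powc uc by simp
      have \<phi>d: "\<phi> ?d = a \<odot>\<^bsub>M\<^esub> x \<oplus>\<^bsub>M\<^esub> \<kappa>"
      proof -
        have "\<phi> ?d = (a \<odot>\<^bsub>M\<^esub> x \<oplus>\<^bsub>M\<^esub> (\<phi> u \<oplus>\<^bsub>M\<^esub> \<kappa>)) \<oplus>\<^bsub>M\<^esub> \<ominus>\<^bsub>M\<^esub> \<phi> u"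
          using lv powc uc by (simp add: a_minus_def map_add map_minus a(2) v' u(2))
        also have "\<dots> = a \<odot>\<^bsub>M\<^esub> x \<oplus>\<^bsub>M\<^esub> \<kappa>"
          using a(1) x uc \<kappa>c H.M.a_lcomm[of "\<phi> u" "a \<odot>\<^bsub>M\<^esub> x" "\<ominus>\<^bsub>M\<^esub> \<phi> u"]
          by (simp add: H.M.a_ac H.M.r_neg)
        finally show ?thesis .
      qed
      have "a = \<zero>\<^bsub>R\<^esub>"
      proof (rule ccontr)
        assume a0: "a \<noteq> \<zero>\<^bsub>R\<^esub>"
        have "a \<odot>\<^bsub>M\<^esub> x = \<ominus>\<^bsub>M\<^esub> \<kappa> \<oplus>\<^bsub>M\<^esub> \<phi> ?d"
          unfolding \<phi>d using a(1) x \<kappa>c by (simp add: H.M.a_ac H.M.r_neg1 H.M.r_neg2)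
        then have ax: "a \<odot>\<^bsub>M\<^esub> x \<in> ?V" using Kc(3)[OF \<kappa>] d by (auto intro: H.set_add_memI)
        obtain b where b: "b \<in> carrier R" "b \<otimes>\<^bsub>R\<^esub> a = \<one>\<^bsub>R\<^esub>"
          using field.field_Units[OF field] a0 a(1) by (auto simp: Units_def)
        have "b \<odot>\<^bsub>M\<^esub> (a \<odot>\<^bsub>M\<^esub> x) = x"
          using a(1) b x by (simp add: H.smult_assoc1[symmetric])
        then show False using H.submoduleE(4)[OF V b(1) ax] notin by simp
      qed
      then have "\<phi> ?d \<in> ?K" using \<phi>d \<kappa> \<kappa>c x by simp
      then have "?d \<in> ?K" using power_kernel_Suc_iff[OF d, of n] stable by simp
      then have "?d \<in> W i" using KW by blast
      then have "?d \<oplus>\<^bsub>M\<^esub> u \<in> W i" using u(1) H.submoduleE(5)[OF W] by blast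
      moreover have "?d \<oplus>\<^bsub>M\<^esub> u = (\<phi> ^^ i) x"
        using powc uc by (simp add: a_minus_def H.M.a_assoc H.M.l_neg)
      ultimately show False using Suc.IH by simp
    qed
  qed
  obtain i where i: "\<forall>m\<ge>i. W m = W i"
    using H.noetherian_chain_stabilizes[where W = W, OF noeth W step] by (elim exE)
  have "W (Suc i) = W i" using i[rule_format, of "Suc i"] by simp
  then show False using orbit[of i] descent[of i] by simp
qed

text \<open>
  Let \<open>n\<close> be such that the kernels of the powers of \<open>\<phi>\<close> are constant from \<open>n\<close> on. If \<open>\<phi>\<^sup>n z\<close> is killed
  by \<open>\<phi>\<^sup>n\<close>, then \<open>z\<close> is killed by \<open>\<phi>\<^sup>2\<^sup>n\<close> and so by \<open>\<phi>\<^sup>n\<close>: the intersection is zero. Iterating the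
  preceding lemma replaces the image of \<open>\<phi>\<close> by the image of any power: the sum is everything.
\<close>

theorem fitting_decomposition:
  assumes field: "field R" and noeth: "H.noetherian_submodule (carrier M)"
  shows "\<exists>n>0. power_kernel n \<inter> (\<phi> ^^ n) ` carrier M = {\<zero>\<^bsub>M\<^esub>} \<and>
    power_kernel n <+>\<^bsub>M\<^esub> (\<phi> ^^ n) ` carrier M = carrier M"
proof -
  obtain n0 where n0: "\<forall>m\<ge>n0. power_kernel m = power_kernel n0"
    using H.noetherian_chain_stabilizes[where W = power_kernel, OF noeth power_kernel_submodule power_kernel_Suc] by (elim exE)
  \<comment> \<open>One step beyond \<open>n0\<close>, so that the exponent is positive even if \<open>\<phi>\<close> is injective.\<close>
  define n where "n = Suc n0"
  have stable: "power_kernel m = power_kernel n" if "m \<ge> n" for m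
    using n0 that by (metis Suc_leD n_def order_refl)
  let ?K = "power_kernel n"
  note K = power_kernel_submodule[of n]
  note Kc = H.submoduleE[OF K] H.submodule_zero_closed[OF K]
  have im: "submodule ((\<phi> ^^ i) ` carrier M) R M" for i
    by (rule linear_map.image_submodule[OF funpow_linear_map H.carrier_is_submodule])
  have "y = \<zero>\<^bsub>M\<^esub>" if y: "y \<in> ?K" "y \<in> (\<phi> ^^ n) ` carrier M" for y
  proof -
    obtain z where z: "z \<in> carrier M" "y = (\<phi> ^^ n) z" using y(2) by blast
    have "z \<in> power_kernel (n + n)" using y(1) z by (simp add: power_kernel_def funpow_add)
    then have "z \<in> ?K" using stable[of "n + n"] by simp
    then show ?thesis using z(2) by (simp add: power_kernel_def)
  qed
  then have int: "?K \<inter> (\<phi> ^^ n) ` carrier M = {\<zero>\<^bsub>M\<^esub>}"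
    using Kc(7) H.submodule_zero_closed[OF im] by blast
  have "x \<in> ?K <+>\<^bsub>M\<^esub> (\<phi> ^^ i) ` carrier M" if "x \<in> carrier M" for x i
    using that
  proof (induction i arbitrary: x)
    case 0
    then show ?case using H.set_add_memI[OF Kc(7), of x "carrier M"] by simp
  next
    case (Suc i)
    obtain \<kappa> y' where \<kappa>: "\<kappa> \<in> ?K" and y': "y' \<in> \<phi> ` carrier M" and xy: "x = \<kappa> \<oplus>\<^bsub>M\<^esub> y'"
      using carrier_eq_kernel_plus_image[OF field noeth stable[OF le_SucI[OF order_refl]] Suc.prems]
      by (rule H.set_add_memE)
    obtain y where y: "y \<in> carrier M" "y' = \<phi> y" using y' by blast
    obtain \<kappa>' z' where \<kappa>': "\<kappa>' \<in> ?K" and z': "z' \<in> (\<phi> ^^ i) ` carrier M" and yz: "y = \<kappa>' \<oplus>\<^bsub>M\<^esub> z'"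
      using Suc.IH[OF y(1)] by (rule H.set_add_memE)
    have z'c: "z' \<in> carrier M" using z' H.submoduleE(1)[OF im] by blast
    have \<kappa>c: "\<kappa> \<in> carrier M" "\<kappa>' \<in> carrier M" using \<kappa> \<kappa>' Kc(1) by blast+
    have "x = (\<kappa> \<oplus>\<^bsub>M\<^esub> \<phi> \<kappa>') \<oplus>\<^bsub>M\<^esub> \<phi> z'"
      using \<kappa>c z'c by (simp add: xy y(2) yz map_add H.M.a_assoc)
    moreover have "\<kappa> \<oplus>\<^bsub>M\<^esub> \<phi> \<kappa>' \<in> ?K" using \<kappa> power_kernel_closed[OF \<kappa>'] Kc(5) by blast
    moreover have "\<phi> z' \<in> (\<phi> ^^ Suc i) ` carrier M" using z' by auto
    ultimately show ?case using H.set_add_memI by simp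
  qed
  then have "?K <+>\<^bsub>M\<^esub> (\<phi> ^^ n) ` carrier M = carrier M"
    using H.submoduleE(1)[OF H.submodule_set_add[OF K im]] by blast
  with int show ?thesis unfolding n_def by blast
qed

end

text \<open>
  For an equivariant endomorphism both Fitting summands are stable under \<open>G\<close>, so one of them
  vanishes.
\<close>

lemma (in group_module) endomorphism_bij_or_nilpotent:
  assumes field: "field K" and noeth: "noetherian_submodule (carrier M)"
    and indec: "indecomposable K G M" and \<phi>: "\<phi> \<in> Hom_over K (carrier G) M M"
  shows "bij_betw \<phi> (carrier M) (carrier M) \<or> (\<exists>n. \<forall>x\<in>carrier M. (\<phi> ^^ n) x = \<zero>\<^bsub>M\<^esub>)"
proof -
  interpret MM: group_module_pair K G M M by unfold_locales
  interpret \<phi>: linear_map K M M \<phi> by (rule MM.Hom_over_linear_map[OF \<phi>])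
  interpret \<phi>: endomorphism K M \<phi> by unfold_locales
  obtain n where n: "n > 0" and int: "\<phi>.power_kernel n \<inter> (\<phi> ^^ n) ` carrier M = {\<zero>\<^bsub>M\<^esub>}"
    and sum: "\<phi>.power_kernel n <+>\<^bsub>M\<^esub> (\<phi> ^^ n) ` carrier M = carrier M"
    using \<phi>.fitting_decomposition[OF field noeth] by blast
  have powc: "(\<phi> ^^ m) x \<in> carrier M" if "x \<in> carrier M" for m x
    using linear_map.map_closed[OF \<phi>.funpow_linear_map that] .
  have pow_act: "(\<phi> ^^ m) (act M g x) = act M g ((\<phi> ^^ m) x)"
    if "g \<in> carrier G" "x \<in> carrier M" for m g x
    using that powc by (induction m) (auto simp: MM.Hom_over_act[OF \<phi>])
  have zero: "act M g \<zero>\<^bsub>M\<^esub> = \<zero>\<^bsub>M\<^esub>" if "g \<in> carrier G" for g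
    using linear_map.map_zero[OF act_linear_map[OF that]] .
  have "group_submodule (\<phi>.power_kernel n) K G M"
    unfolding group_submodule_def using \<phi>.power_kernel_submodule
    by (auto simp: \<phi>.power_kernel_def pow_act zero)
  moreover have "group_submodule ((\<phi> ^^ n) ` carrier M) K G M"
    unfolding group_submodule_def
    using linear_map.image_submodule[OF \<phi>.funpow_linear_map carrier_is_submodule]
    by (auto simp: pow_act[symmetric])
  ultimately consider "\<phi>.power_kernel n = {\<zero>\<^bsub>M\<^esub>}" | "(\<phi> ^^ n) ` carrier M = {\<zero>\<^bsub>M\<^esub>}"
    using indec int sum unfolding indecomposable_def by blast
  then show ?thesis
  proof cases
    case 1
    obtain m where m: "n = Suc m" using n by (cases n) auto
    have "x = y" if xy: "x \<in> carrier M" "y \<in> carrier M" "\<phi> x = \<phi> y" for x y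
    proof -
      have d: "x \<oplus>\<^bsub>M\<^esub> \<ominus>\<^bsub>M\<^esub> y \<in> carrier M" using xy by simp
      have "\<phi> (x \<oplus>\<^bsub>M\<^esub> \<ominus>\<^bsub>M\<^esub> y) = \<zero>\<^bsub>M\<^esub>" using xy by (simp add: \<phi>.map_add \<phi>.map_minus M.r_neg)
      then have "x \<oplus>\<^bsub>M\<^esub> \<ominus>\<^bsub>M\<^esub> y \<in> \<phi>.power_kernel n"
        using d \<phi>.power_kernel_Suc_iff[OF d, of m] \<phi>.power_kernel_submodule[of m]
        by (simp add: m submodule_zero_closed)
      then have diff: "x \<oplus>\<^bsub>M\<^esub> \<ominus>\<^bsub>M\<^esub> y = \<zero>\<^bsub>M\<^esub>" using 1 by blast
      have "x = (x \<oplus>\<^bsub>M\<^esub> \<ominus>\<^bsub>M\<^esub> y) \<oplus>\<^bsub>M\<^esub> y" using xy by (simp add: M.a_assoc M.l_neg)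
      also have "\<dots> = y" unfolding diff using xy(2) by simp
      finally show "x = y" .
    qed
    moreover have "x \<in> \<phi> ` carrier M" if "x \<in> carrier M" for x
    proof -
      have "x \<in> \<phi>.power_kernel n <+>\<^bsub>M\<^esub> (\<phi> ^^ n) ` carrier M" using that sum by simp
      then obtain \<kappa> v where \<kappa>: "\<kappa> \<in> \<phi>.power_kernel n" and v: "v \<in> (\<phi> ^^ n) ` carrier M"
        and x: "x = \<kappa> \<oplus>\<^bsub>M\<^esub> v"
        by (rule set_add_memE)
      obtain w where w: "w \<in> carrier M" "v = (\<phi> ^^ n) w" using v by (rule imageE)
      have "\<kappa> = \<zero>\<^bsub>M\<^esub>" using \<kappa> unfolding 1 by simp
      then have "x = \<phi> ((\<phi> ^^ m) w)" "(\<phi> ^^ m) w \<in> carrier M" using w(1) powc[OF w(1), of n] powc[OF w(1), of m] by (simp_all add: x w(2) m)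
      then show ?thesis by blast
    qed
    ultimately have "bij_betw \<phi> (carrier M) (carrier M)"
      unfolding bij_betw_def inj_on_def by blast
    then show ?thesis ..
  next
    case 2
    then have "\<forall>x\<in>carrier M. (\<phi> ^^ n) x = \<zero>\<^bsub>M\<^esub>" by blast
    then show ?thesis by blast
  qed
qed

section \<open>Homomorphisms that are not split injective\<close>

context group_module_pair
begin

lemma split_injective_if_compose_bij:
  assumes f: "f \<in> Hom_over k (carrier G) M N" and h: "h \<in> Hom_over k (carrier G) N M"
    and bij: "bij_betw (compose (carrier M) h f) (carrier M) (carrier M)"
  shows "split_injective k G M N f"
proof -
  interpret MM: group_module_pair k G M M by unfold_locales
  interpret NM: group_module_pair k G N M by unfold_locales
  let ?\<phi> = "compose (carrier M) h f"
  have \<phi>: "?\<phi> \<in> Hom_over k (carrier G) M M"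
    by (rule Hom_over_compose[OF group_module_pair_axioms NM.group_module_pair_axioms subset_refl subset_refl f h])
  interpret \<phi>: linear_map k M M ?\<phi> by (rule MM.Hom_over_linear_map[OF \<phi>])
  let ?i = "inv_into (carrier M) ?\<phi>"
  have i: "?i x \<in> carrier M" "?\<phi> (?i x) = x" if "x \<in> carrier M" for x
    using that bij by (auto simp: bij_betw_def inv_into_into f_inv_into_f)
  have i\<phi>: "?i (?\<phi> x) = x" if "x \<in> carrier M" for x
    using that bij by (simp add: bij_betw_def)
  have inj: "x = y" if "x \<in> carrier M" "y \<in> carrier M" "?\<phi> x = ?\<phi> y" for x y
    using bij that by (auto simp: bij_betw_def inj_on_def)
  have "linear_map k M M ?i"
  proof unfold_locales
    fix x assume x: "x \<in> carrier M"
    show "?i x \<in> carrier M" using i x by blast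
    show "?i (x \<oplus>\<^bsub>M\<^esub> y) = ?i x \<oplus>\<^bsub>M\<^esub> ?i y" if y: "y \<in> carrier M" for y
      by (rule inj) (use x y in \<open>simp_all add: i \<phi>.map_add\<close>)
    show "?i (a \<odot>\<^bsub>M\<^esub> x) = a \<odot>\<^bsub>M\<^esub> ?i x" if a: "a \<in> carrier k" for a
      by (rule inj) (use x a in \<open>simp_all add: i \<phi>.map_smult\<close>)
  qed
  moreover have "?i (act M g x) = act M g (?i x)" if "g \<in> carrier G" "x \<in> carrier M" for g x
    by (rule inj) (use that in \<open>simp_all add: i MM.Hom_over_act[OF \<phi>]\<close>)
  ultimately have inv: "restrict ?i (carrier M) \<in> Hom_over k (carrier G) M M"
    by (intro MM.Hom_overI subset_refl)
  have "compose (carrier N) (restrict ?i (carrier M)) h \<in> Hom_over k (carrier G) N M"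
    by (rule Hom_over_compose[OF NM.group_module_pair_axioms MM.group_module_pair_axioms
          subset_refl subset_refl h inv])
  moreover have "compose (carrier N) (restrict ?i (carrier M)) h (f x) = x" if x: "x \<in> carrier M" for x
  proof -
    have "f x \<in> carrier N" using Hom_over_closed[OF f x] .
    moreover have "h (f x) \<in> carrier M" using NM.Hom_over_closed[OF h] calculation by blast
    moreover have "?i (h (f x)) = x" using i\<phi>[OF x] x by (simp add: compose_def)
    ultimately show ?thesis by (simp add: compose_def)
  qed
  ultimately show ?thesis unfolding split_injective_def by blast
qed

text \<open>
  This is where the endomorphism ring of \<open>M\<close> being local enters. If \<open>h\<close> splits \<open>f + g\<close>, then
  \<open>h f + h g = 1\<close>. Neither summand is bijective, as \<open>f\<close> and \<open>g\<close> are not split, so both are nilpotent.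
  A nonzero \<open>x\<close> in the kernel of \<open>h f\<close> is then fixed by the nilpotent map \<open>h g\<close>, which is absurd.
\<close>

lemma J_hom_add:
  assumes field: "field k" and noeth: "M.noetherian_submodule (carrier M)"
    and indec: "indecomposable k G M"
    and f: "f \<in> J_hom k G M N" and g: "g \<in> J_hom k G M N"
  shows "(\<lambda>x\<in>carrier M. f x \<oplus>\<^bsub>N\<^esub> g x) \<in> J_hom k G M N"
proof (rule ccontr)
  let ?s = "\<lambda>x\<in>carrier M. f x \<oplus>\<^bsub>N\<^esub> g x"
  interpret MM: group_module_pair k G M M by unfold_locales
  interpret NM: group_module_pair k G N M by unfold_locales
  have fH: "f \<in> Hom_over k (carrier G) M N" and gH: "g \<in> Hom_over k (carrier G) M N"
    using f g by (auto simp: J_hom_def)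
  assume "?s \<notin> J_hom k G M N"
  then have "split_injective k G M N ?s"
    using Hom_over_add[OF subset_refl fH gH] by (simp add: J_hom_def)
  then obtain h where h: "h \<in> Hom_over k (carrier G) N M" and hs: "\<forall>x\<in>carrier M. h (?s x) = x"
    unfolding split_injective_def by blast
  interpret h: linear_map k N M h by (rule NM.Hom_over_linear_map[OF h])
  have nil: "\<exists>n. \<forall>x\<in>carrier M. (compose (carrier M) h u ^^ n) x = \<zero>\<^bsub>M\<^esub>"
    if "u \<in> J_hom k G M N" for u
  proof -
    have u: "u \<in> Hom_over k (carrier G) M N" "\<not> split_injective k G M N u"
      using that by (auto simp: J_hom_def)
    have "compose (carrier M) h u \<in> Hom_over k (carrier G) M M"
      by (rule Hom_over_compose[OF group_module_pair_axioms NM.group_module_pair_axioms subset_refl subset_refl u(1) h])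
    from M.endomorphism_bij_or_nilpotent[OF field noeth indec this]
    show ?thesis using split_injective_if_compose_bij[OF u(1) h] u(2) by blast
  qed
  let ?\<phi> = "compose (carrier M) h f" and ?\<psi> = "compose (carrier M) h g"
  have sum: "?\<phi> x \<oplus>\<^bsub>M\<^esub> ?\<psi> x = x" if "x \<in> carrier M" for x
    using that bspec[OF hs that] Hom_over_closed[OF fH] Hom_over_closed[OF gH]
    by (simp add: compose_def h.map_add)
  have closed: "?\<phi> x \<in> carrier M" "?\<psi> x \<in> carrier M" if "x \<in> carrier M" for x
    using that Hom_over_closed[OF fH] Hom_over_closed[OF gH] by (auto simp: compose_def)
  obtain y where y: "y \<in> carrier M" "y \<noteq> \<zero>\<^bsub>M\<^esub>"
    using indec M.zero_closed unfolding indecomposable_def by blast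
  have powc: "(?\<phi> ^^ i) y \<in> carrier M" for i
    using y(1) closed(1) by (induction i) simp_all
  obtain n where n: "(?\<phi> ^^ n) y = \<zero>\<^bsub>M\<^esub>" using nil[OF f] y(1) by blast
  have "\<exists>i. (?\<phi> ^^ i) y \<noteq> \<zero>\<^bsub>M\<^esub> \<and> (?\<phi> ^^ Suc i) y = \<zero>\<^bsub>M\<^esub>"
  proof (rule ccontr)
    assume "\<not> ?thesis"
    then have "(?\<phi> ^^ i) y \<noteq> \<zero>\<^bsub>M\<^esub>" for i using y(2) by (induction i) auto
    then show False using n by blast
  qed
  then obtain i where i: "(?\<phi> ^^ i) y \<noteq> \<zero>\<^bsub>M\<^esub>" "(?\<phi> ^^ Suc i) y = \<zero>\<^bsub>M\<^esub>" by blast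
  define x where "x = (?\<phi> ^^ i) y"
  have x: "x \<in> carrier M" "x \<noteq> \<zero>\<^bsub>M\<^esub>" "?\<phi> x = \<zero>\<^bsub>M\<^esub>"
    using i powc by (simp_all add: x_def)
  have "?\<psi> x = x" using sum[OF x(1)] x(1,3) closed(2)[OF x(1)] by simp
  then have "(?\<psi> ^^ m) x = x" for m by (induction m) simp_all
  then show False using nil[OF g] x(1,2) by auto
qed

end

context hom_space
begin

text \<open>
  If \<open>h\<close> splits \<open>r f\<close>, then \<open>h\<close> composed with multiplication by \<open>r\<close> splits \<open>f\<close>; so multiples of
  non-split homomorphisms are not split.
\<close>

lemma J_hom_submodule:
  assumes "field k" "M.noetherian_submodule (carrier M)" "indecomposable k G M"
  shows "submodule (J_hom k G M N) R H"
proof (rule H.submoduleI_no_minus)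
  interpret NM: group_module_pair k G N M by unfold_locales
  interpret NN: group_module_pair k G N N by unfold_locales
  show "J_hom k G M N \<subseteq> carrier H" by (auto simp: J_hom_def Hom_module_simps)
  show "f \<oplus>\<^bsub>H\<^esub> g \<in> J_hom k G M N" if "f \<in> J_hom k G M N" "g \<in> J_hom k G M N" for f g
    using MN.J_hom_add[OF assms that] by (simp add: Hom_module_simps)
  have "\<not> split_injective k G M N (\<lambda>x\<in>carrier M. \<zero>\<^bsub>S\<^esub>)"
  proof
    assume "split_injective k G M N (\<lambda>x\<in>carrier M. \<zero>\<^bsub>S\<^esub>)"
    then obtain h where h: "h \<in> Hom_over k (carrier G) N M" "\<forall>x\<in>carrier M. h \<zero>\<^bsub>S\<^esub> = x"
      unfolding split_injective_def by auto
    then have "x = \<zero>\<^bsub>M\<^esub>" if "x \<in> carrier M" for x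
      using that M.zero_closed by metis
    then show False using assms(3) M.zero_closed unfolding indecomposable_def by blast
  qed
  then show "\<zero>\<^bsub>H\<^esub> \<in> J_hom k G M N"
    using MN.Hom_over_zero[OF subset_refl] by (simp add: J_hom_def Hom_module_simps)
  fix r f assume r: "r \<in> carrier R" and "f \<in> J_hom k G M N"
  then have f: "f \<in> Hom_over k (carrier G) M N" and ns: "\<not> split_injective k G M N f"
    by (auto simp: J_hom_def)
  have "\<not> split_injective k G M N (\<lambda>x\<in>carrier M. r \<odot>\<^bsub>S\<^esub> f x)"
  proof
    assume "split_injective k G M N (\<lambda>x\<in>carrier M. r \<odot>\<^bsub>S\<^esub> f x)"
    then obtain h where h: "h \<in> Hom_over k (carrier G) N M" "\<forall>x\<in>carrier M. h (r \<odot>\<^bsub>S\<^esub> f x) = x"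
      unfolding split_injective_def by auto
    have "compose (carrier N) h (scaling r) \<in> Hom_over k (carrier G) N M"
      by (rule Hom_over_compose[OF NN.group_module_pair_axioms NM.group_module_pair_axioms
            subset_refl subset_refl scaling_Hom[OF r] h(1)])
    moreover have "\<forall>x\<in>carrier M. compose (carrier N) h (scaling r) (f x) = x"
      using h(2) MN.Hom_over_closed[OF f] by (simp add: compose_def scaling_def)
    ultimately show False using ns unfolding split_injective_def by blast
  qed
  then show "r \<odot>\<^bsub>H\<^esub> f \<in> J_hom k G M N"
    using Hom_over_smult[OF subset_refl r f] by (simp add: J_hom_def Hom_module_simps)
qed

theorem Hom_split_finite:
  assumes "noetherian_ring R" "finite_module R S" "finite_module k M" "field k" "indecomposable k G M"
  shows "finite_module R (Hom_split k R G M S)"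
  unfolding Hom_split_def
proof (rule H.finite_quotient_module[OF Hom_module_fg[OF assms(1-3)]])
  show "submodule (J_hom k G M N) R H"
    using finite_module.noetherian_carrier[OF assms(3) field.noetherian_ring[OF assms(4)]]
    by (rule J_hom_submodule[OF assms(4) _ assms(5)])
qed

end

section \<open>The trivial module and the finiteness theorem\<close>

lemma trivial_module_simps [simp]:
  "carrier (trivial_module K) = carrier K" "zero (trivial_module K) = zero K"
  "add (trivial_module K) = add K" "smult (trivial_module K) = monoid.mult K"
  "act (trivial_module K) = (\<lambda>g. \<lambda>x\<in>carrier K. x)"
  by (simp_all add: trivial_module_def)

lemma trivial_module_group_module:
  assumes "cring K" "group G"
  shows "group_module K G (trivial_module K)"
proof -
  interpret K: cring K by fact
  interpret G: group G by fact
  have "module K (trivial_module K)"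
  proof (rule moduleI)
    show "abelian_group (trivial_module K)"
    proof (rule abelian_groupI)
      fix x assume "x \<in> carrier (trivial_module K)"
      then show "\<exists>y\<in>carrier (trivial_module K). y \<oplus>\<^bsub>trivial_module K\<^esub> x = \<zero>\<^bsub>trivial_module K\<^esub>"
        by (intro bexI[of _ "\<ominus>\<^bsub>K\<^esub> x"]) (auto simp: K.l_neg)
    qed (auto simp: K.a_ac)
  qed (auto simp: K.l_distr K.r_distr K.m_assoc K.is_cring)
  moreover have "group_action G (carrier (trivial_module K)) (act (trivial_module K))"
    by (intro group_action.intro group_hom.intro group_hom_axioms.intro assms group_BijGroup homI)
      (auto simp: BijGroup_def id_Bij)
  ultimately show ?thesis
    by (intro group_module.intro group_module_axioms.intro) auto
qed

lemma trivial_module_finite: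
  assumes "cring K" "group (G :: ('g, 'd) monoid_scheme)"
  shows "finite_module K (trivial_module K :: ('k, 'k, 'g) gmodule)"
proof -
  interpret K: cring K by fact
  interpret T: group_module K G "trivial_module K :: ('k, 'k, 'g) gmodule"
    by (rule trivial_module_group_module[OF assms])
  have "x \<in> T.lin_span {\<one>\<^bsub>K\<^esub>}" if "x \<in> carrier K" for x
  proof -
    have "submodule (T.lin_span {\<one>\<^bsub>K\<^esub>}) K (trivial_module K :: ('k, 'k, 'g) gmodule)"
      by (rule T.lin_span_submodule) auto
    moreover have "\<one>\<^bsub>K\<^esub> \<in> T.lin_span {\<one>\<^bsub>K\<^esub>}" using T.lin_span_superset[of "{\<one>\<^bsub>K\<^esub>}"] by simp
    ultimately show ?thesis using T.submoduleE(4) that by fastforce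
  qed
  then show ?thesis
    unfolding T.finite_module_iff_fg_submodule T.fg_submodule_def
    by (intro exI[of _ "{\<one>\<^bsub>K\<^esub>}"]) auto
qed

lemma trivial_module_indecomposable:
  assumes "field K" "group (G :: ('g, 'd) monoid_scheme)"
  shows "indecomposable K G (trivial_module K :: ('k, 'k, 'g) gmodule)"
proof -
  interpret K: field K by fact
  let ?T = "trivial_module K :: ('k, 'k, 'g) gmodule"
  interpret T: group_module K G ?T
    by (rule trivial_module_group_module[OF K.is_cring assms(2)])
  have full: "U = carrier K" if U: "submodule U K ?T" "U \<noteq> {\<zero>\<^bsub>K\<^esub>}" for U
  proof -
    have Uc: "U \<subseteq> carrier K" using T.submoduleE(1)[OF U(1)] by simp
    obtain u where u: "u \<in> U" "u \<noteq> \<zero>\<^bsub>K\<^esub>" using U(2) T.submodule_zero_closed[OF U(1)] by auto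
    have uc: "u \<in> carrier K" using u(1) Uc by blast
    then obtain v where v: "v \<in> carrier K" "v \<otimes>\<^bsub>K\<^esub> u = \<one>\<^bsub>K\<^esub>"
      using K.field_Units u(2) by (auto simp: Units_def)
    have "x \<in> U" if x: "x \<in> carrier K" for x
    proof -
      have "(x \<otimes>\<^bsub>K\<^esub> v) \<otimes>\<^bsub>K\<^esub> u = x" using x v uc by (simp add: K.m_assoc)
      moreover have "(x \<otimes>\<^bsub>K\<^esub> v) \<otimes>\<^bsub>K\<^esub> u \<in> U"
        using T.submoduleE(4)[OF U(1) _ u(1), of "x \<otimes>\<^bsub>K\<^esub> v"] x v(1) by simp
      ultimately show ?thesis by simp
    qed
    then show ?thesis using Uc by blast
  qed
  have "carrier K \<noteq> {\<zero>\<^bsub>K\<^esub>}" using K.one_not_zero K.one_closed by blast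
  moreover have "U = {\<zero>\<^bsub>K\<^esub>} \<or> V = {\<zero>\<^bsub>K\<^esub>}"
    if "group_submodule U K G ?T" "group_submodule V K G ?T" "U \<inter> V = {\<zero>\<^bsub>K\<^esub>}" for U V
    using full that unfolding group_submodule_def by blast
  ultimately show ?thesis unfolding indecomposable_def by simp
qed

theorem lemma2p5:
  fixes k :: "('k, 'c) ring_scheme" and p :: nat
    and G :: "('g, 'd) monoid_scheme"
    and R :: "('k, 'r) module" and D :: "int \<Rightarrow> 'r set"
    and S :: "('r, 's, 'g) gmodule" and E :: "int \<Rightarrow> 's set"
    and M :: "('k, 'm, 'g) gmodule"
  assumes "field k" and "ring_characteristic k = p"
    and "group G" and "finite (carrier G)"
    and "graded_algebra k R D"
    and "graded_group_module R D G S E"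
    and "group_module k G M" and "finite_module k M" and "indecomposable k G M"
    and "noetherian_ring R"
    and "finite_module R S"
  shows "(\<forall>\<X>. (\<forall>P\<in>\<X>. p_subgroup p G P) \<longrightarrow> finite_module R (Hom_rel k R G \<X> M S)) \<and>
    finite_module R (Hom_split k R G M S) \<and>
    finite_module R (brauer_quotient p k R G S) \<and>
    finite_module R (split_quotient k R G S)"
proof -
  interpret k: field k by fact
  have R: "algebra k R" using assms(5) by (rule graded_algebra.axioms(1))
  have S: "group_module R G S" using assms(6) by (rule graded_group_module.axioms(1))
  interpret M: hom_space k R G S M by (intro hom_space.intro R S assms)
  let ?T = "trivial_module k :: ('k, 'k, 'g) gmodule"
  note T = trivial_module_finite[OF k.is_cring assms(3)] trivial_module_indecomposable[OF assms(1,3)]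
  interpret T: hom_space k R G S ?T
    by (intro hom_space.intro R S trivial_module_group_module k.is_cring assms)
  have "finite_module R (Hom_rel k R G \<X> M S)" if "\<forall>P\<in>\<X>. p_subgroup p G P" for \<X>
    using that by (intro M.Hom_rel_finite assms) (simp add: p_subgroup_def)
  moreover have "finite_module R (Hom_split k R G M S)" by (intro M.Hom_split_finite assms)
  moreover have "finite_module R (brauer_quotient p k R G S)"
    unfolding brauer_quotient_def by (intro T.Hom_rel_finite assms T) (simp add: p_subgroup_def)
  moreover have "finite_module R (split_quotient k R G S)"
    unfolding split_quotient_def by (intro T.Hom_split_finite assms T)
  ultimately show ?thesis by blast
qed

end
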